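(* The map $$\gamma(r,\rho)=\big((r^{-1}\mathbb{Z},\rho),(\mathbb{Z},\rho)\big),\qquad(r,\rho)\in G,$$ defines an isomorphism of locally compact étale groupoids between $G$ and the quotient $\mathcal{R}/\mathbb{R}^*_+$ of the equivalence relation $\mathcal{R}$ of commensurability on the space of $\mathbb{Q}$-lattices in $\mathbb{R}$ by the natural scaling action of $\mathbb{R}^*_+$.
   Context: $R=\prod_p\mathbb{Z}_p=\mathrm{Hom}(\mathbb{Q}/\mathbb{Z},\mathbb{Q}/\mathbb{Z})$ (a compact ring), inside the finite adeles $\mathbb{A}_f$. $G$ is the locally compact étale groupoid of pairs $(r,\rho)$ with $r\in\mathbb{Q}^*_+$ (discrete), $\rho\in R$, $r\rho\in R$, with composition $(r_1,\rho_1)\circ(r_2,\rho_2)=(r_1r_2,\rho_2)$ when $r_2\rho_2=\rho_1$. A $\mathbb{Q}$-lattice in $\mathbb{R}$ is a pair $(\Lambda,\phi)$ with $\Lambda$ a lattice in $\mathbb{R}$ and $\phi:\mathbb{Q}/\mathbb{Z}\to\mathbb{Q}\Lambda/\Lambda$ a group homomorphism; every one is uniquely of the form $(\lambda\mathbb{Z},\lambda\rho)$, $\lambda>0$, $\rho\in R$, and the space of $\mathbb{Q}$-lattices is topologized as $\mathbb{R}^*_+\times R$. In $(r^{-1}\mathbb{Z},\rho)$ the homomorphism is $r^{-1}(r\rho):\mathbb{Q}/\mathbb{Z}\to\mathbb{Q}/r^{-1}\mathbb{Z}$, i.e. $(r^{-1}\mathbb{Z},\rho)=r^{-1}(\mathbb{Z},r\rho)$.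 Two $\mathbb{Q}$-lattices $(\Lambda_1,\phi_1),(\Lambda_2,\phi_2)$ are commensurable iff $\Lambda_1,\Lambda_2$ are commensurable (their intersection has finite index in each) and $\phi_1-\phi_2=0$ modulo $\Lambda_1+\Lambda_2$. This is an equivalence relation; $\mathcal{R}$ is the groupoid of pairs of commensurable $\mathbb{Q}$-lattices with composition $(l_1,l_2)\circ(l_2,l_3)=(l_1,l_3)$. The scaling action of $\lambda\in\mathbb{R}^*_+$ is $(\Lambda,\phi)\mapsto(\lambda\Lambda,\lambda\phi)$, applied diagonally to pairs; it is free, so $\mathcal{R}/\mathbb{R}^*_+$ is a groupoid. Topology on $\mathcal{R}$: a pair $(l_1,l_2)\in\mathcal{R}$ is determined by $l_2$ and the ratio of covolumes $|\Lambda_2|/|\Lambda_1|\in\mathbb{Q}^*_+$, and $\mathcal{R}$ has the topology induced from $\mathbb{Q}^*_+\times\{\mathbb{Q}\text{-lattices}\}$ with $\mathbb{Q}^*_+$ discrete; $\mathcal{R}/\mathbb{R}^*_+$ has the quotient topology. *)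

theory Defs
  imports "HOL-Analysis.Analysis"
begin

section \<open>The ring of profinite integers inside the finite adeles\<close>

quotient_type qz = rat / "\<lambda>x y :: rat. x - y \<in> \<int>"
  morphisms rep_qz mk_qz
proof (rule equivpI)
  show "reflp (\<lambda>x y :: rat. x - y \<in> \<int>)" by (simp add: reflp_def)
  show "symp (\<lambda>x y :: rat. x - y \<in> \<int>)"
    by (metis (mono_tags, lifting) Ints_minus minus_diff_eq sympI)
  show "transp (\<lambda>x y :: rat. x - y \<in> \<int>)"
  proof (rule transpI)
    fix x y z :: rat assume "x - y \<in> \<int>" "y - z \<in> \<int>"
    from Ints_add[OF this] show "x - z \<in> \<int>" by simp
  qed
qed

instantiation qz :: ab_group_add
begin

lift_definition zero_qz :: qz is 0 .

lift_definition plus_qz :: "qz \<Rightarrow> qz \<Rightarrow> qz" is "(+)"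
  by (metis Ints_add add_diff_add)

lift_definition uminus_qz :: "qz \<Rightarrow> qz" is uminus
  by (metis Ints_minus minus_diff_minus)

lift_definition minus_qz :: "qz \<Rightarrow> qz \<Rightarrow> qz" is "(-)"
proof -
  fix a b c d :: rat assume "a - b \<in> \<int>" "c - d \<in> \<int>"
  from Ints_diff[OF this] show "a - c - (b - d) \<in> \<int>" by (simp add: algebra_simps)
qed

instance
  by standard (transfer; simp)+

end

typedef zhat = "{f :: qz \<Rightarrow> qz. \<forall>x y. f (x + y) = f x + f y}"
  morphisms zhat_app Abs_zhat
  by (rule exI[of _ id]) simp

setup_lifting type_definition_zhat

lemma zhat_app_add: "zhat_app f (x + y) = zhat_app f x + zhat_app f y"
  using zhat_app[of f] by simp

lemma zhat_app_0 [simp]: "zhat_app f 0 = 0"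
  by (metis zhat_app_add add_cancel_right_left)

lemma mk_qz_add: "mk_qz (x + y) = mk_qz x + mk_qz y"
  by (simp add: plus_qz.abs_eq)

lemma mk_qz_cases: obtains q where "x = mk_qz q"
  by (metis Quotient3_abs_rep Quotient3_qz)

fun nat_mult :: "nat \<Rightarrow> 'a::ab_group_add \<Rightarrow> 'a" where
  "nat_mult 0 x = 0"
| "nat_mult (Suc n) x = x + nat_mult n x"

lemma nat_mult_mk_qz: "nat_mult n (mk_qz q) = mk_qz (of_nat n * q)"
  by (induction n) (simp_all add: zero_qz.abs_eq mk_qz_add algebra_simps)

lemma zhat_app_nat_mult: "zhat_app f (nat_mult n x) = nat_mult n (zhat_app f x)"
  by (induction n) (simp_all add: zhat_app_add)

lemma mk_qz_eq_0_iff: "mk_qz q = 0 \<longleftrightarrow> q \<in> \<int>"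
  by (simp add: zero_qz_def qz.abs_eq_iff)

lemma torsion_qz:
  assumes "n > 0" "nat_mult n x = 0"
  obtains k where "x = nat_mult k (mk_qz (1 / of_nat n))"
proof -
  obtain q where q: "x = mk_qz q" by (rule mk_qz_cases)
  have "of_nat n * q \<in> \<int>"
    using assms(2) by (simp add: q nat_mult_mk_qz mk_qz_eq_0_iff)
  then obtain m where m: "of_nat n * q = of_int m" by (auto elim: Ints_cases)
  define k where "k = nat (m mod int n)"
  have k: "int k = m mod int n" using assms(1) by (simp add: k_def)
  have "rat_of_int m = of_nat n * of_int (m div int n) + of_int (m mod int n)"
    by (metis mult_div_mod_eq of_int_add of_int_mult of_int_of_nat_eq)
  then have "of_nat n * q = of_nat n * of_int (m div int n) + of_nat k"
    unfolding m k[symmetric] by simp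
  then have "q - of_nat k * (1 / of_nat n) = of_int (m div int n)"
    using assms(1) by (simp add: field_simps)
  then have "x = mk_qz (of_nat k * (1 / of_nat n))"
    by (simp add: q qz.abs_eq_iff)
  then have "x = nat_mult k (mk_qz (1 / of_nat n))"
    by (simp add: nat_mult_mk_qz)
  then show ?thesis by (rule that)
qed

lemma zhat_app_multiple:
  obtains n k l y where "x = nat_mult n y" "zhat_app f y = nat_mult k y"
    "zhat_app g y = nat_mult l y"
proof -
  obtain q where q: "x = mk_qz q" by (rule mk_qz_cases)
  obtain a b where ab: "q = of_int a / of_int b" "b > 0"
    by (metis quotient_of_denom_pos quotient_of_div surj_pair)
  define m where "m = nat b"
  have m: "m > 0" "rat_of_int b = of_nat m" using ab by (simp_all add: m_def)
  define y where "y = mk_qz (1 / of_nat m)"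
  have tor: "nat_mult m y = 0"
    using m by (simp add: y_def nat_mult_mk_qz mk_qz_eq_0_iff)
  have *: "\<exists>k. zhat_app h y = nat_mult k y" for h
  proof -
    have "nat_mult m (zhat_app h y) = 0"
      using tor by (simp flip: zhat_app_nat_mult)
    then show ?thesis using torsion_qz[OF m(1)] unfolding y_def by metis
  qed
  have "nat_mult m x = 0"
    using m ab by (simp add: q nat_mult_mk_qz mk_qz_eq_0_iff)
  then obtain n where "x = nat_mult n y"
    using torsion_qz[OF m(1)] unfolding y_def by metis
  moreover obtain k where "zhat_app f y = nat_mult k y" using * by blast
  moreover obtain l where "zhat_app g y = nat_mult l y" using * by blast
  ultimately show ?thesis by (rule that)
qed

text \<open>Multiplication is composition, so the type is the endomorphism ring
  \<open>Hom(Q/Z, Q/Z)\<close>.\<close>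

instantiation zhat :: comm_ring_1
begin

lift_definition zero_zhat :: zhat is "\<lambda>x. 0" by simp

lift_definition one_zhat :: zhat is "\<lambda>x. x" by simp

lift_definition plus_zhat :: "zhat \<Rightarrow> zhat \<Rightarrow> zhat" is "\<lambda>f g x. f x + g x"
  by simp

lift_definition uminus_zhat :: "zhat \<Rightarrow> zhat" is "\<lambda>f x. - f x"
  by simp

lift_definition minus_zhat :: "zhat \<Rightarrow> zhat \<Rightarrow> zhat" is "\<lambda>f g x. f x - g x"
  by simp

lift_definition times_zhat :: "zhat \<Rightarrow> zhat \<Rightarrow> zhat" is "\<lambda>f g x. f (g x)"
  by simp

instance
proof
  fix a b c :: zhat
  show "a * b = b * a"
  proof -
    have "zhat_app a (zhat_app b x) = zhat_app b (zhat_app a x)" for x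
    proof -
      obtain n k l y where y: "x = nat_mult n y" "zhat_app a y = nat_mult k y"
        "zhat_app b y = nat_mult l y"
        by (rule zhat_app_multiple)
      obtain q where q: "y = mk_qz q" by (rule mk_qz_cases)
      show ?thesis
        by (simp add: y(1) zhat_app_nat_mult y(2,3)) (simp add: q nat_mult_mk_qz ac_simps)
    qed
    then show ?thesis
      by (simp add: times_zhat.rep_eq fun_eq_iff flip: zhat_app_inject)
  qed
  show "(0::zhat) \<noteq> 1"
  proof
    assume "(0::zhat) = 1"
    then have "zhat_app 0 (mk_qz (1/2)) = zhat_app 1 (mk_qz (1/2))" by simp
    then have "(1/2 :: rat) \<in> \<int>"
      by (metis mk_qz_eq_0_iff one_zhat.rep_eq zero_zhat.rep_eq)
    then obtain k where "(1/2 :: rat) = of_int k" by (auto elim: Ints_cases)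
    then have "(1::rat) = of_int (2 * k)" by simp
    then have "1 = 2 * k" by (metis of_int_1 of_int_eq_iff)
    then show False by presburger
  qed
  show "(a + b) * c = a * c + b * c" by transfer simp
qed (transfer; simp add: fun_eq_iff algebra_simps)+

end

lemma zhat_app_of_nat: "zhat_app (of_nat n * f) x = nat_mult n (zhat_app f x)"
  by (induction n) (simp_all add: zero_zhat.rep_eq plus_zhat.rep_eq algebra_simps)

lemma zhat_torsion_free:
  assumes "of_int n * f = (0 :: zhat)" "n \<noteq> 0"
  shows "f = 0"
proof -
  have *: "f = 0" if "of_nat m * f = 0" "m > 0" for m
  proof -
    have "zhat_app f x = 0" for x
    proof -
      obtain q where "x = mk_qz q" by (rule mk_qz_cases)
      then have "x = nat_mult m (mk_qz (q / of_nat m))"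
        using that(2) by (simp add: nat_mult_mk_qz)
      then show ?thesis
        by (metis that(1) zhat_app_of_nat zhat_app_nat_mult zero_zhat.rep_eq)
    qed
    then show ?thesis
      by (simp add: zero_zhat.rep_eq fun_eq_iff flip: zhat_app_inject)
  qed
  show ?thesis
  proof (cases "n > 0")
    case True
    then show ?thesis using *[of "nat n"] assms by simp
  next
    case False
    then show ?thesis using *[of "nat (- n)"] assms by simp
  qed
qed

text \<open>The product topology on the product of all \<open>Z_p\<close> is the topology of pointwise
  convergence on \<open>Hom(Q/Z, Q/Z)\<close>, with \<open>Q/Z\<close> discrete.\<close>

definition zhat_topology :: "zhat topology" where
  "zhat_topology =
     pullback_topology UNIV zhat_app (product_topology (\<lambda>_. discrete_topology UNIV) UNIV)"

text \<open>The finite adeles as the localisation of \<open>zhat\<close> at the nonzero integers, that is, the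
  tensor product of \<open>zhat\<close> with the rationals. The pair \<open>(a, m)\<close> represents \<open>a / m\<close>.\<close>

definition adele_rel :: "zhat \<times> int \<Rightarrow> zhat \<times> int \<Rightarrow> bool" where
  "adele_rel x y \<longleftrightarrow>
     snd x \<noteq> 0 \<and> snd y \<noteq> 0 \<and> of_int (snd y) * fst x = of_int (snd x) * fst y"

lemma part_equivp_adele_rel: "part_equivp adele_rel"
proof (rule part_equivpI)
  show "\<exists>x. adele_rel x x" by (rule exI[of _ "(0, 1)"]) (simp add: adele_rel_def)
  show "symp adele_rel" by (simp add: symp_def adele_rel_def)
  show "transp adele_rel"
  proof (rule transpI)
    fix x y z assume xy: "adele_rel x y" and yz: "adele_rel y z"
    have "of_int (snd y) * (of_int (snd z) * fst x - of_int (snd x) * fst z)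
      = of_int (snd z) * (of_int (snd y) * fst x) - of_int (snd x) * (of_int (snd y) * fst z)"
      by (simp add: algebra_simps)
    also have "\<dots> = of_int (snd z) * (of_int (snd x) * fst y)
        - of_int (snd x) * (of_int (snd z) * fst y)"
      using xy yz by (simp add: adele_rel_def)
    also have "\<dots> = 0" by (simp add: algebra_simps)
    finally have "of_int (snd z) * fst x - of_int (snd x) * fst z = 0"
      by (rule zhat_torsion_free) (use xy in \<open>simp add: adele_rel_def\<close>)
    then show "adele_rel x z" using xy yz by (simp add: adele_rel_def)
  qed
qed

quotient_type fin_adele = "zhat \<times> int" / partial: adele_rel
  by (rule part_equivp_adele_rel)

instantiation fin_adele :: comm_ring_1
begin

lift_definition zero_fin_adele :: fin_adele is "(0, 1)" by (simp add: adele_rel_def)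

lift_definition one_fin_adele :: fin_adele is "(1, 1)" by (simp add: adele_rel_def)

lift_definition plus_fin_adele :: "fin_adele \<Rightarrow> fin_adele \<Rightarrow> fin_adele"
  is "\<lambda>x y. (of_int (snd y) * fst x + of_int (snd x) * fst y, snd x * snd y)"
proof -
  fix x x' y y' assume x: "adele_rel x x'" and y: "adele_rel y y'"
  define a b c d where "a = (of_int (snd x) :: zhat)" and "b = (of_int (snd x') :: zhat)"
    and "c = (of_int (snd y) :: zhat)" and "d = (of_int (snd y') :: zhat)"
  have 1: "b * fst x = a * fst x'" "d * fst y = c * fst y'"
    using x y by (simp_all add: adele_rel_def a_def b_def c_def d_def)
  have "b * d * (c * fst x + a * fst y) = c * d * (b * fst x) + a * b * (d * fst y)"
    by (simp add: algebra_simps)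
  also have "\<dots> = a * c * (d * fst x' + b * fst y')"
    by (simp add: 1 algebra_simps)
  finally show "adele_rel (of_int (snd y) * fst x + of_int (snd x) * fst y, snd x * snd y)
      (of_int (snd y') * fst x' + of_int (snd x') * fst y', snd x' * snd y')"
    using x y by (simp add: adele_rel_def a_def b_def c_def d_def)
qed

lift_definition uminus_fin_adele :: "fin_adele \<Rightarrow> fin_adele" is "\<lambda>x. (- fst x, snd x)"
  by (simp add: adele_rel_def)

definition minus_fin_adele :: "fin_adele \<Rightarrow> fin_adele \<Rightarrow> fin_adele" where
  "minus_fin_adele x y = x + - y"

lift_definition times_fin_adele :: "fin_adele \<Rightarrow> fin_adele \<Rightarrow> fin_adele"
  is "\<lambda>x y. (fst x * fst y, snd x * snd y)"
proof -
  fix x x' y y' assume x: "adele_rel x x'" and y: "adele_rel y y'"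
  define a b c d where "a = (of_int (snd x) :: zhat)" and "b = (of_int (snd x') :: zhat)"
    and "c = (of_int (snd y) :: zhat)" and "d = (of_int (snd y') :: zhat)"
  have 1: "b * fst x = a * fst x'" "d * fst y = c * fst y'"
    using x y by (simp_all add: adele_rel_def a_def b_def c_def d_def)
  have "b * d * (fst x * fst y) = (b * fst x) * (d * fst y)"
    by (simp add: algebra_simps)
  also have "\<dots> = a * c * (fst x' * fst y')" by (simp add: 1 algebra_simps)
  finally show "adele_rel (fst x * fst y, snd x * snd y) (fst x' * fst y', snd x' * snd y')"
    using x y by (simp add: adele_rel_def a_def b_def c_def d_def)
qed

instance
proof
  show "(0::fin_adele) \<noteq> 1" by transfer (simp add: adele_rel_def)
  show "a - b = a + - b" for a b :: fin_adele by (simp add: minus_fin_adele_def)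
qed (transfer; simp add: adele_rel_def algebra_simps)+

end

definition adele_of_zhat :: "zhat \<Rightarrow> fin_adele" where
  "adele_of_zhat a = abs_fin_adele (a, 1)"

definition adele_of_rat :: "rat \<Rightarrow> fin_adele" where
  "adele_of_rat r = (case quotient_of r of (m, n) \<Rightarrow> abs_fin_adele (of_int m, n))"

lemma inj_adele_of_zhat: "inj adele_of_zhat"
proof (rule injI)
  fix a b assume "adele_of_zhat a = adele_of_zhat b"
  moreover have "adele_rel (c, 1) (c, 1)" for c by (simp add: adele_rel_def)
  ultimately have "adele_rel (a, 1) (b, 1)"
    unfolding adele_of_zhat_def using Quotient3_rel[OF Quotient3_fin_adele] by blast
  then show "a = b" by (simp add: adele_rel_def)
qed

definition rat_mult_zhat :: "rat \<Rightarrow> zhat \<Rightarrow> zhat" where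
  "rat_mult_zhat r \<rho> = (THE \<sigma>. adele_of_zhat \<sigma> = adele_of_rat r * adele_of_zhat \<rho>)"


section \<open>Topological groupoids\<close>

text \<open>A groupoid is given by its set of arrows (the carrier of \<open>gtop\<close>), a partially defined
  composition and an inverse; objects are identified with unit arrows.\<close>

record 'a top_groupoid =
  gtop :: "'a topology"
  composable :: "('a \<times> 'a) set"
  gcomp :: "'a \<Rightarrow> 'a \<Rightarrow> 'a"
  ginv :: "'a \<Rightarrow> 'a"

definition is_groupoid :: "'a top_groupoid \<Rightarrow> bool" where
  "is_groupoid G \<longleftrightarrow>
     composable G \<subseteq> topspace (gtop G) \<times> topspace (gtop G) \<and>
     (\<forall>(g, h) \<in> composable G. gcomp G g h \<in> topspace (gtop G)) \<and>
     (\<forall>g h k. (g, h) \<in> composable G \<longrightarrow> (h, k) \<in> composable G \<longrightarrow>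
        (gcomp G g h, k) \<in> composable G \<and> (g, gcomp G h k) \<in> composable G \<and>
        gcomp G (gcomp G g h) k = gcomp G g (gcomp G h k)) \<and>
     (\<forall>g \<in> topspace (gtop G).
        ginv G g \<in> topspace (gtop G) \<and> ginv G (ginv G g) = g \<and> (g, ginv G g) \<in> composable G) \<and>
     (\<forall>(g, h) \<in> composable G.
        gcomp G (ginv G g) (gcomp G g h) = h \<and> gcomp G (gcomp G g h) (ginv G h) = g)"

definition grange :: "'a top_groupoid \<Rightarrow> 'a \<Rightarrow> 'a" where
  "grange G g = gcomp G g (ginv G g)"

definition gsource :: "'a top_groupoid \<Rightarrow> 'a \<Rightarrow> 'a" where
  "gsource G g = gcomp G (ginv G g) g"

definition gunits :: "'a top_groupoid \<Rightarrow> 'a set" where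
  "gunits G = grange G ` topspace (gtop G)"

definition is_top_groupoid :: "'a top_groupoid \<Rightarrow> bool" where
  "is_top_groupoid G \<longleftrightarrow> is_groupoid G \<and>
     continuous_map (subtopology (prod_topology (gtop G) (gtop G)) (composable G)) (gtop G)
       (\<lambda>(g, h). gcomp G g h) \<and>
     continuous_map (gtop G) (gtop G) (ginv G)"

definition local_homeomorphism :: "'a topology \<Rightarrow> 'b topology \<Rightarrow> ('a \<Rightarrow> 'b) \<Rightarrow> bool" where
  "local_homeomorphism X Y f \<longleftrightarrow> f \<in> topspace X \<rightarrow> topspace Y \<and>
     (\<forall>x \<in> topspace X. \<exists>U. openin X U \<and> x \<in> U \<and> openin Y (f ` U) \<and>
        homeomorphic_map (subtopology X U) (subtopology Y (f ` U)) f)"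

text \<open>As usual for locally compact groupoids, the Hausdorff property is part of the notion.\<close>

definition lc_etale_groupoid :: "'a top_groupoid \<Rightarrow> bool" where
  "lc_etale_groupoid G \<longleftrightarrow> is_top_groupoid G \<and>
     locally_compact_space (gtop G) \<and> Hausdorff_space (gtop G) \<and>
     local_homeomorphism (gtop G) (subtopology (gtop G) (gunits G)) (grange G) \<and>
     local_homeomorphism (gtop G) (subtopology (gtop G) (gunits G)) (gsource G)"

definition top_groupoid_iso ::
    "'a top_groupoid \<Rightarrow> 'b top_groupoid \<Rightarrow> ('a \<Rightarrow> 'b) \<Rightarrow> bool" where
  "top_groupoid_iso G H f \<longleftrightarrow>
     homeomorphic_map (gtop G) (gtop H) f \<and>
     (\<forall>g \<in> topspace (gtop G). \<forall>h \<in> topspace (gtop G).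
        (g, h) \<in> composable G \<longleftrightarrow> (f g, f h) \<in> composable H) \<and>
     (\<forall>(g, h) \<in> composable G. f (gcomp G g h) = gcomp H (f g) (f h))"

definition quotient_topology :: "'a topology \<Rightarrow> ('a \<Rightarrow> 'b) \<Rightarrow> 'b topology" where
  "quotient_topology X f =
     topology (\<lambda>U. U \<subseteq> f ` topspace X \<and> openin X {x \<in> topspace X. f x \<in> U})"

lemma openin_quotient_topology:
  "openin (quotient_topology X f) U \<longleftrightarrow>
     U \<subseteq> f ` topspace X \<and> openin X {x \<in> topspace X. f x \<in> U}"
proof -
  have "istopology (\<lambda>U. U \<subseteq> f ` topspace X \<and> openin X {x \<in> topspace X. f x \<in> U})"
    unfolding istopology_def
  proof (intro conjI allI impI)
    fix S T
    assume S: "S \<subseteq> f ` topspace X \<and> openin X {x \<in> topspace X. f x \<in> S}"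
      and T: "T \<subseteq> f ` topspace X \<and> openin X {x \<in> topspace X. f x \<in> T}"
    have "openin X ({x \<in> topspace X. f x \<in> S} \<inter> {x \<in> topspace X. f x \<in> T})"
      using S T by blast
    then show "openin X {x \<in> topspace X. f x \<in> S \<inter> T}"
      by (rule back_subst) blast
    show "S \<inter> T \<subseteq> f ` topspace X" using S by blast
  next
    fix K assume K: "\<forall>S\<in>K. S \<subseteq> f ` topspace X \<and> openin X {x \<in> topspace X. f x \<in> S}"
    have "{x \<in> topspace X. f x \<in> \<Union>K} = (\<Union>S\<in>K. {x \<in> topspace X. f x \<in> S})" by auto
    then show "openin X {x \<in> topspace X. f x \<in> \<Union>K}" using K by auto
    show "\<Union>K \<subseteq> f ` topspace X" using K by blast
  qed
  then show ?thesis by (simp add: quotient_topology_def topology_inverse')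
qed

lemma quotient_map_quotient_topology: "quotient_map X (quotient_topology X f) f"
proof -
  have "{x \<in> topspace X. f x \<in> f ` topspace X} = topspace X" by blast
  then have "openin (quotient_topology X f) (f ` topspace X)"
    by (simp add: openin_quotient_topology)
  then have "topspace (quotient_topology X f) = f ` topspace X"
    by (metis openin_quotient_topology openin_subset openin_topspace subset_antisym)
  then show ?thesis by (simp add: quotient_map_def openin_quotient_topology)
qed

text \<open>The quotient by a free action by automorphisms whose orbit map is \<open>orb\<close>. The set
  products below are then single orbits.\<close>

definition quotient_groupoid :: "'a top_groupoid \<Rightarrow> ('a \<Rightarrow> 'a set) \<Rightarrow> 'a set top_groupoid" where
  "quotient_groupoid G orb =
     \<lparr> gtop = quotient_topology (gtop G) orb,
       composable = map_prod orb orb ` composable G,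
       gcomp = (\<lambda>A B. {gcomp G a b | a b. a \<in> A \<and> b \<in> B \<and> (a, b) \<in> composable G}),
       ginv = (\<lambda>A. ginv G ` A) \<rparr>"


section \<open>The groupoid of partially defined multiplication by positive rationals\<close>

definition G_arrows :: "(rat \<times> zhat) set" where
  "G_arrows = {(r, \<rho>). r > 0 \<and> adele_of_rat r * adele_of_zhat \<rho> \<in> range adele_of_zhat}"

definition G_groupoid :: "(rat \<times> zhat) top_groupoid" where
  "G_groupoid =
     \<lparr> gtop = subtopology (prod_topology (discrete_topology {0<..}) zhat_topology) G_arrows,
       composable = {((r1, \<rho>1), (r2, \<rho>2)).
         (r1, \<rho>1) \<in> G_arrows \<and> (r2, \<rho>2) \<in> G_arrows \<and>
         adele_of_rat r2 * adele_of_zhat \<rho>2 = adele_of_zhat \<rho>1},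
       gcomp = (\<lambda>(r1, \<rho>1) (r2, \<rho>2). (r1 * r2, \<rho>2)),
       ginv = (\<lambda>(r, \<rho>). (inverse r, rat_mult_zhat r \<rho>)) \<rparr>"


section \<open>Lattices with a labelling of their torsion points, and commensurability\<close>

definition is_lattice :: "real set \<Rightarrow> bool" where
  "is_lattice \<Lambda> \<longleftrightarrow>
     0 \<in> \<Lambda> \<and> (\<forall>x\<in>\<Lambda>. \<forall>y\<in>\<Lambda>. x - y \<in> \<Lambda>) \<and> discrete \<Lambda> \<and>
     (\<exists>K. compact K \<and> K + \<Lambda> = UNIV)"

definition rational_span :: "real set \<Rightarrow> real set" where
  "rational_span \<Lambda> = {of_rat q * l | q l. l \<in> \<Lambda>}"

text \<open>In \<open>(\<Lambda>, \<phi>)\<close> the values of \<open>\<phi>\<close> are cosets of \<open>\<Lambda>\<close>, added as sets.\<close>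

type_synonym q_lattice = "real set \<times> (qz \<Rightarrow> real set)"

definition q_lattices :: "q_lattice set" where
  "q_lattices = {(\<Lambda>, \<phi>). is_lattice \<Lambda> \<and>
     (\<forall>x. \<exists>t \<in> rational_span \<Lambda>. \<phi> x = t +o \<Lambda>) \<and>
     (\<forall>x y. \<phi> (x + y) = \<phi> x + \<phi> y)}"

definition scale_lattice :: "real \<Rightarrow> q_lattice \<Rightarrow> q_lattice" where
  "scale_lattice c = (\<lambda>(\<Lambda>, \<phi>). (c *o \<Lambda>, \<lambda>x. c *o \<phi> x))"

definition qz_coset :: "qz \<Rightarrow> real set" where
  "qz_coset x = of_rat ` {q. mk_qz q = x}"

definition integer_lattice :: "zhat \<Rightarrow> q_lattice" where
  "integer_lattice \<rho> = (\<int>, \<lambda>x. qz_coset (zhat_app \<rho> x))"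

definition q_lattice_topology :: "q_lattice topology" where
  "q_lattice_topology =
     quotient_topology (prod_topology (top_of_set {0<..}) zhat_topology)
       (\<lambda>(c, \<rho>). scale_lattice c (integer_lattice \<rho>))"

definition finite_index :: "real set \<Rightarrow> real set \<Rightarrow> bool" where
  "finite_index H L \<longleftrightarrow> H \<subseteq> L \<and> finite {x +o H | x. x \<in> L}"

definition commensurable :: "(q_lattice \<times> q_lattice) set" where
  "commensurable = {((\<Lambda>1, \<phi>1), (\<Lambda>2, \<phi>2)).
     (\<Lambda>1, \<phi>1) \<in> q_lattices \<and> (\<Lambda>2, \<phi>2) \<in> q_lattices \<and>
     finite_index (\<Lambda>1 \<inter> \<Lambda>2) \<Lambda>1 \<and> finite_index (\<Lambda>1 \<inter> \<Lambda>2) \<Lambda>2 \<and>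
     (\<forall>x. \<forall>a \<in> \<phi>1 x. \<forall>b \<in> \<phi>2 x. a - b \<in> \<Lambda>1 + \<Lambda>2)}"

text \<open>The measure of a Borel fundamental domain; it does not depend on the choice.\<close>

definition covolume :: "real set \<Rightarrow> real" where
  "covolume \<Lambda> = measure lborel (SOME F. F \<in> sets borel \<and> (\<forall>x. \<exists>!l. l \<in> \<Lambda> \<and> x - l \<in> F))"

definition commensurability_groupoid :: "(q_lattice \<times> q_lattice) top_groupoid" where
  "commensurability_groupoid =
     \<lparr> gtop = pullback_topology commensurable
         (\<lambda>(l1, l2). (covolume (fst l2) / covolume (fst l1), l2))
         (prod_topology (discrete_topology {q \<in> \<rat>. q > 0}) q_lattice_topology),
       composable = {((l1, l2), (l2', l3)).
         (l1, l2) \<in> commensurable \<and> (l2', l3) \<in> commensurable \<and> l2 = l2'},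
       gcomp = (\<lambda>(l1, l2) (l2', l3). (l1, l3)),
       ginv = (\<lambda>(l1, l2). (l2, l1)) \<rparr>"

definition scaling_orbit :: "q_lattice \<times> q_lattice \<Rightarrow> (q_lattice \<times> q_lattice) set" where
  "scaling_orbit = (\<lambda>(l1, l2). {(scale_lattice c l1, scale_lattice c l2) | c. c > 0})"

definition commensurability_mod_scaling :: "(q_lattice \<times> q_lattice) set top_groupoid" where
  "commensurability_mod_scaling = quotient_groupoid commensurability_groupoid scaling_orbit"

text \<open>The first component is the lattice \<open>r\<^sup>-\<^sup>1 Z\<close> labelled by
  \<open>r\<^sup>-\<^sup>1 (r \<rho>)\<close>.\<close>

definition gamma_map :: "rat \<times> zhat \<Rightarrow> (q_lattice \<times> q_lattice) set" where
  "gamma_map = (\<lambda>(r, \<rho>). scaling_orbit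
     (scale_lattice (inverse (of_rat r)) (integer_lattice (rat_mult_zhat r \<rho>)),
      integer_lattice \<rho>))"

end

theory Submission
  imports Defs
begin

text \<open>The starting point is that \<open>r \<rho>\<close> lies in \<open>R\<close> exactly when \<open>\<rho>\<close> kills the class of \<open>r\<close> in
  \<open>Q/Z\<close>, and then \<open>(r \<rho>)(q) = \<rho>(r q)\<close>. So over each \<open>r\<close> the arrows of \<open>G\<close> form a clopen
  subset of the compact space \<open>R\<close>, and \<open>G\<close> is locally compact and etale. Every one-dimensional
  \<open>Q\<close>-lattice is \<open>c (Z, \<rho>)\<close> for unique \<open>c\<close> and \<open>\<rho>\<close>, and \<open>c (Z, \<rho>)\<close> is commensurable with
  \<open>d (Z, \<sigma>)\<close> iff \<open>d = c r\<close> for a rational \<open>r\<close> with \<open>\<rho> = r \<sigma>\<close>: writing \<open>r = a / b\<close> in lowest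
  terms, congruence of the labels modulo \<open>Z + r Z = (1 / b) Z\<close> says \<open>b \<rho> = a \<sigma>\<close>. Hence the pairs
  are the scalings of the values of \<open>\<gamma>\<close>, and the covolume ratio together with the label of the
  second lattice is a continuous scaling-invariant map that induces the inverse of \<open>\<gamma>\<close>. Being
  locally compact and etale is then transported along \<open>\<gamma>\<close>.\<close>

section \<open>Rational multiples in the profinite integers\<close>

lemma zhat_eqI:
  assumes "\<And>q. zhat_app a (mk_qz q) = zhat_app b (mk_qz q)"
  shows "a = b"
  by (metis assms ext mk_qz_cases zhat_app_inject)

lemma zhat_app_mk_uminus: "zhat_app f (mk_qz (- q)) = - zhat_app f (mk_qz q)"
  by (metis add.right_inverse add_eq_0_iff mk_qz_add zhat_app_0 zhat_app_add zero_qz.abs_eq)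

lemma zhat_app_of_int: "zhat_app (of_int n * f) (mk_qz q) = zhat_app f (mk_qz (of_int n * q))"
proof (cases n)
  case (nonneg k)
  then show ?thesis
    by (simp add: zhat_app_of_nat flip: zhat_app_nat_mult nat_mult_mk_qz)
next
  \<comment> \<open>Here n is -(k + 1), so the case of the natural number \<open>Suc k\<close>
    applies after a change of sign.\<close>
  case (neg k)
  have "zhat_app (of_int n * f) (mk_qz q) = - zhat_app (of_nat (Suc k) * f) (mk_qz q)"
    by (simp only: neg of_int_minus of_int_of_nat_eq mult_minus_left uminus_zhat.rep_eq)
  also have "\<dots> = zhat_app f (mk_qz (- (of_nat (Suc k) * q)))"
    by (simp add: zhat_app_of_nat zhat_app_mk_uminus del: of_nat_Suc flip: zhat_app_nat_mult nat_mult_mk_qz)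
  finally show ?thesis by (simp add: neg algebra_simps)
qed

text \<open>Since f is additive, n can be moved out of its argument, and the element
  \<open>of_int n\<close> of R acts on Q/Z as multiplication by n.\<close>

lemma zhat_app_int_multiple:
  assumes "zhat_app f (mk_qz q) = mk_qz p"
  shows "zhat_app f (mk_qz (of_int n * q)) = mk_qz (of_int n * p)"
proof -
  have "zhat_app f (mk_qz (of_int n * q)) = zhat_app (of_int n) (zhat_app f (mk_qz q))"
    by (simp add: times_zhat.rep_eq flip: zhat_app_of_int)
  also have "\<dots> = mk_qz (of_int n * p)"
    using zhat_app_of_int[of n 1 p] by (simp add: assms one_zhat.rep_eq)
  finally show ?thesis .
qed

lemma abs_fin_adele_eq_iff:
  assumes "m \<noteq> 0" "n \<noteq> 0"
  shows "abs_fin_adele (a, m) = abs_fin_adele (b, n) \<longleftrightarrow> of_int n * a = of_int m * b"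
proof -
  have "adele_rel x x" if "snd x \<noteq> 0" for x using that by (simp add: adele_rel_def)
  then have "abs_fin_adele (a, m) = abs_fin_adele (b, n) \<longleftrightarrow> adele_rel (a, m) (b, n)"
    using Quotient3_rel[OF Quotient3_fin_adele, of "(a, m)" "(b, n)"] assms by auto
  then show ?thesis using assms by (simp add: adele_rel_def)
qed

text \<open>\<open>adele_of_rat\<close> is defined from the reduced fraction; cross multiplication
  of integers, carried over to R, shows that every other fraction gives the same adele.\<close>

lemma adele_of_rat_eq:
  assumes "n \<noteq> 0"
  shows "adele_of_rat (of_int m / of_int n) = abs_fin_adele (of_int m, n)"
proof -
  obtain a b where ab: "quotient_of (of_int m / of_int n) = (a, b)" by fastforce
  then have b: "b \<noteq> 0" using quotient_of_denom_pos by fastforce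
  have "rat_of_int m / of_int n = of_int a / of_int b" using ab quotient_of_div by blast
  then have "rat_of_int (n * a) = rat_of_int (b * m)"
    using assms b by (simp add: field_simps)
  then have "n * a = b * m" by (simp only: of_int_eq_iff)
  then have "of_int n * of_int a = (of_int b * of_int m :: zhat)" by (metis of_int_mult)
  then show ?thesis using assms b by (simp add: adele_of_rat_def ab abs_fin_adele_eq_iff)
qed

text \<open>The rationals are divisible: substituting q / n or n q for q passes between the two
  forms.\<close>

lemma zhat_app_cross_mult_iff:
  assumes "n \<noteq> 0"
  shows "(\<forall>q. zhat_app \<sigma> (mk_qz (of_int n * q)) = zhat_app \<rho> (mk_qz (of_int m * q))) \<longleftrightarrow>
     (\<forall>q. zhat_app \<sigma> (mk_qz q) = zhat_app \<rho> (mk_qz (of_int m / of_int n * q)))"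
proof safe
  fix q
  assume "\<forall>q. zhat_app \<sigma> (mk_qz (of_int n * q)) = zhat_app \<rho> (mk_qz (of_int m * q))"
  then show "zhat_app \<sigma> (mk_qz q) = zhat_app \<rho> (mk_qz (of_int m / of_int n * q))"
    using assms by (elim allE[of _ "q / of_int n"]) simp
next
  fix q
  assume "\<forall>q. zhat_app \<sigma> (mk_qz q) = zhat_app \<rho> (mk_qz (of_int m / of_int n * q))"
  then show "zhat_app \<sigma> (mk_qz (of_int n * q)) = zhat_app \<rho> (mk_qz (of_int m * q))"
    using assms by (elim allE[of _ "of_int n * q"]) simp
qed

text \<open>Clearing denominators reduces the adelic equation to one in R, and evaluation on Q/Z
  turns that into a condition on rationals. The rest of the proof handles r \<rho> through its
  values.\<close>

lemma adele_of_rat_mult_eq_iff: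
  "adele_of_rat r * adele_of_zhat \<rho> = adele_of_zhat \<sigma> \<longleftrightarrow>
     (\<forall>q. zhat_app \<sigma> (mk_qz q) = zhat_app \<rho> (mk_qz (r * q)))"
proof -
  obtain m n where r: "r = of_int m / of_int n" and n: "n \<noteq> 0"
    by (metis less_numeral_extra(3) quotient_of_denom_pos quotient_of_div surj_pair)
  have "adele_of_rat r * adele_of_zhat \<rho> = abs_fin_adele (of_int m * \<rho>, n)"
    using n by (simp add: r adele_of_rat_eq adele_of_zhat_def times_fin_adele.abs_eq eq_onp_def adele_rel_def)
  then have "adele_of_rat r * adele_of_zhat \<rho> = adele_of_zhat \<sigma> \<longleftrightarrow> of_int m * \<rho> = of_int n * \<sigma>"
    using n by (simp add: adele_of_zhat_def abs_fin_adele_eq_iff)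
  also have "\<dots> \<longleftrightarrow> (\<forall>q. zhat_app \<sigma> (mk_qz (of_int n * q)) = zhat_app \<rho> (mk_qz (of_int m * q)))"
    by (metis zhat_app_of_int zhat_eqI)
  also have "\<dots> \<longleftrightarrow> (\<forall>q. zhat_app \<sigma> (mk_qz q) = zhat_app \<rho> (mk_qz (r * q)))"
    using n by (simp add: r zhat_app_cross_mult_iff)
  finally show ?thesis .
qed

lemma zhat_app_of_int_mult_eq_0:
  assumes "zhat_app \<rho> (mk_qz r) = 0"
  shows "zhat_app \<rho> (mk_qz (r * of_int n)) = 0"
proof -
  have "zhat_app \<rho> (mk_qz (r * of_nat k)) = 0" for k
    by (induction k) (auto simp: algebra_simps mk_qz_add zhat_app_add assms simp flip: zero_qz.abs_eq)
  then show ?thesis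
    by (cases n) (auto simp: zhat_app_mk_uminus simp del: of_nat_Suc)
qed

text \<open>\<open>r \<rho>\<close> must send \<open>mk_qz q\<close> to \<open>\<rho> (mk_qz (r q))\<close>; this depends only on \<open>q\<close> modulo
  the integers exactly when \<open>\<rho>\<close> vanishes at \<open>r\<close>.\<close>

lemma ex_rat_multiple_iff:
  "(\<exists>\<sigma>. \<forall>q. zhat_app \<sigma> (mk_qz q) = zhat_app \<rho> (mk_qz (r * q))) \<longleftrightarrow> zhat_app \<rho> (mk_qz r) = 0"
proof safe
  fix \<sigma> assume "\<forall>q. zhat_app \<sigma> (mk_qz q) = zhat_app \<rho> (mk_qz (r * q))"
  then have "zhat_app \<rho> (mk_qz (r * 1)) = zhat_app \<sigma> (mk_qz 1)" by metis
  moreover have "mk_qz 1 = 0" by (simp add: mk_qz_eq_0_iff)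
  ultimately show "zhat_app \<rho> (mk_qz r) = 0" by simp
next
  assume r: "zhat_app \<rho> (mk_qz r) = 0"
  define f where "f x = zhat_app \<rho> (mk_qz (r * rep_qz x))" for x
  have f: "f (mk_qz q) = zhat_app \<rho> (mk_qz (r * q))" for q
  proof -
    have "mk_qz (rep_qz (mk_qz q)) = mk_qz q" by (metis Quotient3_abs_rep Quotient3_qz)
    then obtain n where "rep_qz (mk_qz q) - q = of_int n" by (auto simp: qz.abs_eq_iff elim: Ints_cases)
    then have "r * rep_qz (mk_qz q) = r * q + r * of_int n" by (simp add: algebra_simps)
    then show ?thesis
      by (simp add: f_def mk_qz_add zhat_app_add zhat_app_of_int_mult_eq_0[OF r])
  qed
  have "f (x + y) = f x + f y" for x y
  proof -
    obtain p q where "x = mk_qz p" "y = mk_qz q" by (metis mk_qz_cases)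
    then show ?thesis
      by (metis f distrib_left mk_qz_add zhat_app_add)
  qed
  then have "\<forall>q. zhat_app (Abs_zhat f) (mk_qz q) = zhat_app \<rho> (mk_qz (r * q))"
    by (simp add: Abs_zhat_inverse f)
  then show "\<exists>\<sigma>. \<forall>q. zhat_app \<sigma> (mk_qz q) = zhat_app \<rho> (mk_qz (r * q))" by blast
qed

text \<open>Over a fixed r, membership is a condition on one value of \<rho>. As Q/Z is discrete, it
  cuts out a clopen subset of R, which is what makes G locally compact and etale.\<close>

lemma G_arrows_iff: "(r, \<rho>) \<in> G_arrows \<longleftrightarrow> r > 0 \<and> zhat_app \<rho> (mk_qz r) = 0"
  by (simp add: G_arrows_def image_iff adele_of_rat_mult_eq_iff ex_rat_multiple_iff)

text \<open>The description in \<open>rat_mult_zhat_def\<close> has at most one solution because R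
  embeds in the finite adeles.\<close>

lemma rat_mult_zhat_unique:
  assumes "\<And>q. zhat_app \<sigma> (mk_qz q) = zhat_app \<rho> (mk_qz (r * q))"
  shows "rat_mult_zhat r \<rho> = \<sigma>"
proof -
  have \<sigma>: "adele_of_rat r * adele_of_zhat \<rho> = adele_of_zhat \<sigma>"
    using assms by (simp add: adele_of_rat_mult_eq_iff)
  show ?thesis
    unfolding rat_mult_zhat_def \<sigma> by (rule the_equality) (auto dest: injD[OF inj_adele_of_zhat])
qed

lemma zhat_app_rat_mult:
  assumes "(r, \<rho>) \<in> G_arrows"
  shows "zhat_app (rat_mult_zhat r \<rho>) (mk_qz q) = zhat_app \<rho> (mk_qz (r * q))"
proof -
  from assms obtain \<sigma> where \<sigma>: "\<And>q. zhat_app \<sigma> (mk_qz q) = zhat_app \<rho> (mk_qz (r * q))"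
    unfolding G_arrows_iff ex_rat_multiple_iff[symmetric] by blast
  then have "rat_mult_zhat r \<rho> = \<sigma>" by (rule rat_mult_zhat_unique)
  then show ?thesis by (simp add: \<sigma>)
qed

lemma adele_of_rat_mult_eq_rat_mult_zhat:
  assumes "(r, \<rho>) \<in> G_arrows"
  shows "adele_of_rat r * adele_of_zhat \<rho> = adele_of_zhat \<sigma> \<longleftrightarrow> \<sigma> = rat_mult_zhat r \<rho>"
  unfolding adele_of_rat_mult_eq_iff
  using assms by (auto simp: zhat_app_rat_mult intro: zhat_eqI)

lemma rat_mult_zhat_1 [simp]: "rat_mult_zhat 1 \<rho> = \<rho>"
  by (rule rat_mult_zhat_unique) simp

lemma G_arrows_1 [simp]: "(1, \<rho>) \<in> G_arrows"
  using mk_qz_eq_0_iff[of 1] by (simp add: G_arrows_iff)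

text \<open>The value of s \<sigma> at the class of r is the value of \<sigma> at the class of r
  s.\<close>

lemma G_arrows_mult:
  assumes "(s, \<sigma>) \<in> G_arrows" "(r, rat_mult_zhat s \<sigma>) \<in> G_arrows"
  shows "(r * s, \<sigma>) \<in> G_arrows"
  using assms by (auto simp: G_arrows_iff zhat_app_rat_mult mult.commute)

lemma rat_mult_zhat_mult:
  assumes "(s, \<sigma>) \<in> G_arrows" "(r, rat_mult_zhat s \<sigma>) \<in> G_arrows"
  shows "rat_mult_zhat r (rat_mult_zhat s \<sigma>) = rat_mult_zhat (r * s) \<sigma>"
  by (rule rat_mult_zhat_unique) (simp add: zhat_app_rat_mult assms G_arrows_mult ac_simps)

text \<open>The value of r \<rho> at the class of 1 / r is the value of \<rho> at the class of 1,
  which is zero.\<close>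

lemma G_arrows_inverse:
  assumes "(r, \<rho>) \<in> G_arrows"
  shows "(inverse r, rat_mult_zhat r \<rho>) \<in> G_arrows"
  using assms zhat_app_rat_mult[OF assms] mk_qz_eq_0_iff[of 1]
  by (auto simp: G_arrows_iff)

lemma rat_mult_zhat_inverse:
  assumes "(r, \<rho>) \<in> G_arrows"
  shows "rat_mult_zhat (inverse r) (rat_mult_zhat r \<rho>) = \<rho>"
  using assms rat_mult_zhat_mult[OF assms G_arrows_inverse[OF assms]] by (auto simp: G_arrows_iff)

section \<open>The topology of the profinite integers\<close>

lemma topspace_zhat [simp]: "topspace zhat_topology = UNIV"
  by (simp add: zhat_topology_def topspace_pullback_topology)

text \<open>This is the universal property of the topology of pointwise convergence. Compactness of
  R and continuity of inversion are checked in this form.\<close>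

lemma continuous_map_into_zhat:
  "continuous_map X zhat_topology f \<longleftrightarrow>
     (\<forall>q. continuous_map X (discrete_topology UNIV) (\<lambda>x. zhat_app (f x) (mk_qz q)))"
    (is "?lhs \<longleftrightarrow> ?rhs")
proof
  let ?P = "product_topology (\<lambda>_::qz. discrete_topology (UNIV :: qz set)) UNIV"
  have "continuous_map zhat_topology ?P (id \<circ> zhat_app)"
    unfolding zhat_topology_def by (rule continuous_map_pullback) auto
  moreover assume ?lhs
  ultimately have "continuous_map X ?P (id \<circ> zhat_app \<circ> f)" by (rule continuous_map_compose[rotated])
  then show ?rhs by (simp add: continuous_map_componentwise_UNIV)
next
  let ?P = "product_topology (\<lambda>_::qz. discrete_topology (UNIV :: qz set)) UNIV"
  assume r: ?rhs
  have "continuous_map X (discrete_topology UNIV) (\<lambda>x. zhat_app (f x) y)" for y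
    by (cases y rule: mk_qz_cases) (use r in auto)
  then have "continuous_map X ?P (zhat_app \<circ> f)" by (simp add: continuous_map_componentwise_UNIV)
  then show ?lhs unfolding zhat_topology_def by (rule continuous_map_pullback') auto
qed

lemma continuous_map_zhat_app:
  "continuous_map zhat_topology (discrete_topology UNIV) (\<lambda>\<rho>. zhat_app \<rho> (mk_qz q))"
  using continuous_map_into_zhat[of zhat_topology id] by auto

text \<open>Two distinct endomorphisms differ at some class, and evaluation there separates them
  because its fibres are open.\<close>

lemma Hausdorff_space_zhat: "Hausdorff_space zhat_topology"
  unfolding Hausdorff_space_def
proof (intro allI impI)
  fix a b assume "a \<in> topspace zhat_topology \<and> b \<in> topspace zhat_topology \<and> a \<noteq> b"
  then obtain q where q: "zhat_app a (mk_qz q) \<noteq> zhat_app b (mk_qz q)" using zhat_eqI by blast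
  have "openin zhat_topology {\<rho>. zhat_app \<rho> (mk_qz q) \<in> S}" for S
    using openin_continuous_map_preimage[OF continuous_map_zhat_app] by fastforce
  from this[of "{zhat_app a (mk_qz q)}"] this[of "{zhat_app b (mk_qz q)}"]
  show "\<exists>U V. openin zhat_topology U \<and> openin zhat_topology V \<and> a \<in> U \<and> b \<in> V \<and> disjnt U V"
    using q
    by (intro exI[of _ "{\<rho>. zhat_app \<rho> (mk_qz q) \<in> {zhat_app a (mk_qz q)}}"]
        exI[of _ "{\<rho>. zhat_app \<rho> (mk_qz q) \<in> {zhat_app b (mk_qz q)}}"]) (auto simp: disjnt_iff)
qed

lemma nat_mult_zhat_app_mk_qz:
  assumes "b > 0"
  shows "nat_mult b (zhat_app \<rho> (mk_qz (of_int a / of_nat b))) = 0"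
proof -
  have "mk_qz (of_int a) = 0" by (simp add: mk_qz_eq_0_iff)
  then show ?thesis using assms by (simp add: nat_mult_mk_qz flip: zhat_app_nat_mult)
qed

lemma finite_torsion_qz:
  assumes "n > 0"
  shows "finite {x :: qz. nat_mult n x = 0}"
proof (rule finite_subset)
  show "{x :: qz. nat_mult n x = 0} \<subseteq> (\<lambda>k. mk_qz (of_nat k / of_nat n)) ` {..<n}"
  proof clarsimp
    fix x :: qz assume "nat_mult n x = 0"
    then obtain k where k: "x = nat_mult k (mk_qz (1 / of_nat n))" using torsion_qz assms by blast
    \<comment> \<open>Reducing k modulo n changes k / n by an integer and puts the numerator into a
      finite range.\<close>
    have "(of_nat k :: rat) = of_nat n * of_nat (k div n) + of_nat (k mod n)"
      by (metis mult_div_mod_eq of_nat_add of_nat_mult)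
    then have "of_nat k / of_nat n - of_nat (k mod n) / of_nat n = (of_nat (k div n) :: rat)"
        using assms by (simp add: field_simps)
    then have "x = mk_qz (of_nat (k mod n) / of_nat n)"
      by (simp add: k nat_mult_mk_qz qz.abs_eq_iff)
    then show "x \<in> (\<lambda>k. mk_qz (of_nat k / of_nat n)) ` {..<n}" using assms by auto
  qed
qed simp

text \<open>A homomorphism sends a class with denominator b into the b-torsion of Q/Z, and this
  torsion is finite.\<close>

lemma finite_range_zhat_app: "finite (range (\<lambda>\<rho>. zhat_app \<rho> x))"
proof -
  obtain q where q: "x = mk_qz q" by (rule mk_qz_cases)
  obtain a b where ab: "q = of_int a / of_int b" "b > 0"
    by (metis quotient_of_denom_pos quotient_of_div surj_pair)
  then have "q = of_int a / of_nat (nat b)" by simp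
  then have "range (\<lambda>\<rho>. zhat_app \<rho> x) \<subseteq> {y. nat_mult (nat b) y = 0}"
    using nat_mult_zhat_app_mk_qz[of "nat b" _ a] ab(2) by (auto simp: q)
  then show ?thesis using finite_torsion_qz[of "nat b"] ab(2) by (auto intro: finite_subset)
qed

text \<open>R is the continuous image of a closed subspace of a product of finite discrete spaces,
  which is compact by Tychonoff.\<close>

lemma compact_space_zhat: "compact_space zhat_topology"
proof -
  \<comment> \<open>Restricting each factor to the values that are taken makes it finite; the full
    factor Q/Z would be infinite.\<close>
  define T where "T x = range (\<lambda>\<rho>. zhat_app \<rho> x)" for x
  define P where "P = product_topology (\<lambda>x. discrete_topology (T x)) UNIV"
  have P: "compact_space P"
    unfolding P_def by (simp add: compact_space_product_topology T_def finite_range_zhat_app compact_space_discrete_topology)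
  have proj: "continuous_map P (discrete_topology UNIV) (\<lambda>f. f x)" for x
  proof -
    have "continuous_map P (discrete_topology UNIV) (id \<circ> (\<lambda>f. f x))"
      unfolding P_def
      by (rule continuous_map_compose[OF continuous_map_product_projection]) auto
    then show ?thesis by (simp add: comp_def)
  qed
  have add: "continuous_map P (discrete_topology UNIV) (\<lambda>f. f x + f y)" for x y
  proof -
    have "continuous_map P (discrete_topology (UNIV \<times> UNIV)) (\<lambda>f. (f x, f y))"
      unfolding prod_topology_discrete_topology by (simp add: continuous_map_pairwise comp_def proj)
    then have "continuous_map P (discrete_topology UNIV) ((\<lambda>(a, b). a + b) \<circ> (\<lambda>f. (f x, f y)))"
      by (rule continuous_map_compose) auto
    then show ?thesis by (simp add: comp_def)
  qed
  \<comment> \<open>\<open>H\<close> consists of the additive functions in the product; each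
    equation is closed because the discrete target is Hausdorff.\<close>
  define H where "H = (\<Inter>(x, y) \<in> UNIV. {f \<in> topspace P. f (x + y) = f x + f y})"
  have app: "zhat_app (Abs_zhat f) = f" if "f \<in> H" for f
    using that by (auto simp: H_def Abs_zhat_inverse)
  have "closedin P H"
    unfolding H_def by (intro closedin_INT) (auto intro!: closedin_continuous_maps_eq[OF _ proj add])
  then have "compact_space (subtopology P H)"
    by (simp add: P closedin_compact_space compact_space_subtopology)
  moreover have "continuous_map (subtopology P H) zhat_topology Abs_zhat"
    unfolding continuous_map_into_zhat
    by (intro allI continuous_map_eq[OF continuous_map_from_subtopology[OF proj]]) (simp add: app)
  moreover have "Abs_zhat ` topspace (subtopology P H) = UNIV"
  proof -
    have "zhat_app \<rho> \<in> topspace (subtopology P H)" for \<rho>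
      by (auto simp: H_def P_def T_def zhat_app_add)
    then show ?thesis by (metis UNIV_eq_I imageI zhat_app_inverse)
  qed
  ultimately show ?thesis
    using image_compactin[of "subtopology P H" "topspace (subtopology P H)" zhat_topology Abs_zhat]
    by (simp add: compact_space_def)
qed

section \<open>The groupoid of partial multiplications\<close>

text \<open>Slices over the points of a discrete factor are open, so continuity may be tested slice
  by slice, and the map on a slice may depend on a in any way.\<close>

lemma continuous_map_prod_discrete:
  assumes "\<And>a. a \<in> A \<Longrightarrow> continuous_map X Y (\<lambda>x. f (a, x))"
  shows "continuous_map (prod_topology (discrete_topology A) X) Y f"
  unfolding continuous_map_def
proof (intro conjI allI impI)
  show "f \<in> topspace (prod_topology (discrete_topology A) X) \<rightarrow> topspace Y"
    using continuous_map_funspace[OF assms] by fastforce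
next
  fix U assume U: "openin Y U"
  have "openin (prod_topology (discrete_topology A) X) ({a} \<times> {x \<in> topspace X. f (a, x) \<in> U})"
    if "a \<in> A" for a
    using that openin_continuous_map_preimage[OF assms U] by (simp add: openin_prod_Times_iff)
  then have "openin (prod_topology (discrete_topology A) X)
      (\<Union>a\<in>A. {a} \<times> {x \<in> topspace X. f (a, x) \<in> U})" by blast
  moreover have "(\<Union>a\<in>A. {a} \<times> {x \<in> topspace X. f (a, x) \<in> U}) =
      {z \<in> topspace (prod_topology (discrete_topology A) X). f z \<in> U}" by auto
  ultimately show "openin (prod_topology (discrete_topology A) X)
      {z \<in> topspace (prod_topology (discrete_topology A) X). f z \<in> U}" by simp
qed

lemma gtop_G: "gtop G_groupoid = subtopology (prod_topology (discrete_topology {0<..}) zhat_topology) G_arrows"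
  by (simp add: G_groupoid_def)

lemma topspace_G [simp]: "topspace (gtop G_groupoid) = G_arrows"
  by (auto simp: gtop_G G_arrows_iff)

lemma composable_G_iff:
  "((r, \<rho>), (s, \<sigma>)) \<in> composable G_groupoid \<longleftrightarrow>
     (r, \<rho>) \<in> G_arrows \<and> (s, \<sigma>) \<in> G_arrows \<and> \<rho> = rat_mult_zhat s \<sigma>"
  by (auto simp: G_groupoid_def adele_of_rat_mult_eq_rat_mult_zhat)

lemma gcomp_G [simp]: "gcomp G_groupoid (r, \<rho>) (s, \<sigma>) = (r * s, \<sigma>)"
  by (simp add: G_groupoid_def)

lemma ginv_G [simp]: "ginv G_groupoid (r, \<rho>) = (inverse r, rat_mult_zhat r \<rho>)"
  by (simp add: G_groupoid_def)

lemma is_groupoid_G: "is_groupoid G_groupoid"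
  unfolding is_groupoid_def
  apply (intro conjI)
  subgoal by (auto simp: composable_G_iff)
  subgoal by (auto simp: composable_G_iff G_arrows_mult)
  subgoal by (auto simp: composable_G_iff G_arrows_mult rat_mult_zhat_mult)
  subgoal by (auto simp: composable_G_iff G_arrows_inverse rat_mult_zhat_inverse)
  subgoal by (auto simp: composable_G_iff rat_mult_zhat_mult G_arrows_iff)
  done

lemma gsource_G:
  assumes "(r, \<rho>) \<in> G_arrows"
  shows "gsource G_groupoid (r, \<rho>) = (1, \<rho>)"
  using assms by (simp add: gsource_def G_arrows_iff)

lemma grange_G:
  assumes "(r, \<rho>) \<in> G_arrows"
  shows "grange G_groupoid (r, \<rho>) = (1, rat_mult_zhat r \<rho>)"
  using assms by (simp add: grange_def G_arrows_iff)

lemma gunits_G: "gunits G_groupoid = {1} \<times> UNIV"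
proof -
  have "(1, \<rho>) \<in> grange G_groupoid ` G_arrows" for \<rho>
    by (rule image_eqI[of _ _ "(1, \<rho>)"]) (simp_all add: grange_G)
  then show ?thesis by (auto simp: gunits_def grange_G)
qed

text \<open>Arrows have positive first component, so the first coordinate may be tested in all of Q
  with the discrete topology.\<close>

lemma continuous_map_into_G:
  "continuous_map X (gtop G_groupoid) f \<longleftrightarrow>
     continuous_map X (discrete_topology UNIV) (fst \<circ> f) \<and> continuous_map X zhat_topology (snd \<circ> f) \<and>
     f ` topspace X \<subseteq> G_arrows"
proof -
  have "continuous_map X (discrete_topology {0<..}) (fst \<circ> f) \<longleftrightarrow>
      continuous_map X (discrete_topology UNIV) (fst \<circ> f)" if "f ` topspace X \<subseteq> G_arrows"
  proof -
    have "fst g > 0" if "g \<in> G_arrows" for g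
      using that by (cases g) (simp add: G_arrows_iff)
    then have "(fst \<circ> f) \<in> topspace X \<rightarrow> {0<..}"
      using that unfolding image_subset_iff Pi_iff comp_apply by blast
    then show ?thesis
      using continuous_map_in_subtopology[of X "discrete_topology UNIV" "{0<..}" "fst \<circ> f"]
      by (simp add: subtopology_discrete_topology)
  qed
  then show ?thesis
    by (auto simp: gtop_G continuous_map_in_subtopology continuous_map_pairwise image_subset_iff_funcset)
qed

lemma continuous_map_fst_G: "continuous_map (gtop G_groupoid) (discrete_topology UNIV) fst"
  and continuous_map_snd_G: "continuous_map (gtop G_groupoid) zhat_topology snd"
  using continuous_map_into_G[of "gtop G_groupoid" id] by auto

text \<open>The point of evaluation may vary with r because r ranges over a discrete space. Taking
  \<open>h\<close> as multiplication by q gives the values of r \<rho>.\<close>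

lemma continuous_map_eval_G:
  "continuous_map (gtop G_groupoid) (discrete_topology UNIV) (\<lambda>g. zhat_app (snd g) (mk_qz (h (fst g))))"
  unfolding gtop_G
  by (intro continuous_map_from_subtopology continuous_map_prod_discrete) (simp add: continuous_map_zhat_app)

lemma continuous_map_ginv_G: "continuous_map (gtop G_groupoid) (gtop G_groupoid) (ginv G_groupoid)"
  unfolding continuous_map_into_G
proof (intro conjI)
  have "continuous_map (gtop G_groupoid) (discrete_topology UNIV) (inverse \<circ> fst)"
    by (rule continuous_map_compose[OF continuous_map_fst_G]) auto
  then show "continuous_map (gtop G_groupoid) (discrete_topology UNIV) (fst \<circ> ginv G_groupoid)"
    by (rule continuous_map_eq) auto
  show "continuous_map (gtop G_groupoid) zhat_topology (snd \<circ> ginv G_groupoid)"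
    unfolding continuous_map_into_zhat
  proof
    fix q
    show "continuous_map (gtop G_groupoid) (discrete_topology UNIV)
        (\<lambda>x. zhat_app ((snd \<circ> ginv G_groupoid) x) (mk_qz q))"
      by (rule continuous_map_eq[OF continuous_map_eval_G[of "\<lambda>r. r * q"]]) (auto simp: zhat_app_rat_mult)
  qed
  show "ginv G_groupoid ` topspace (gtop G_groupoid) \<subseteq> G_arrows" by (auto simp: G_arrows_inverse)
qed

lemma is_top_groupoid_G: "is_top_groupoid G_groupoid"
  unfolding is_top_groupoid_def
proof (intro conjI is_groupoid_G continuous_map_ginv_G)
  let ?P = "prod_topology (gtop G_groupoid) (gtop G_groupoid)"
  have f: "continuous_map ?P (discrete_topology UNIV) (fst \<circ> fst)"
    "continuous_map ?P (discrete_topology UNIV) (fst \<circ> snd)"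
    "continuous_map ?P zhat_topology (snd \<circ> snd)"
    by (rule continuous_map_compose continuous_map_fst continuous_map_snd continuous_map_fst_G continuous_map_snd_G)+
  \<comment> \<open>A product of two discrete spaces is discrete, so multiplication of the rational
    components is continuous on it.\<close>
  then have "continuous_map ?P (discrete_topology (UNIV \<times> UNIV)) (\<lambda>z. (fst (fst z), fst (snd z)))"
    unfolding prod_topology_discrete_topology by (simp add: continuous_map_pairwise comp_def)
  then have "continuous_map ?P (discrete_topology UNIV) ((\<lambda>(a, b). a * b) \<circ> (\<lambda>z. (fst (fst z), fst (snd z))))"
    by (rule continuous_map_compose) auto
  moreover have "(\<lambda>(a, b). a * b) \<circ> (\<lambda>z. (fst (fst z), fst (snd z))) = fst \<circ> (\<lambda>(g, h). gcomp G_groupoid g h)"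
    by (auto simp: fun_eq_iff G_groupoid_def)
  moreover have "snd \<circ> snd = snd \<circ> (\<lambda>(g, h). gcomp G_groupoid g h)"
    by (auto simp: fun_eq_iff G_groupoid_def)
  moreover have "(\<lambda>(g, h). gcomp G_groupoid g h) ` composable G_groupoid \<subseteq> G_arrows"
    by (auto simp: composable_G_iff G_arrows_mult)
  ultimately show "continuous_map (subtopology ?P (composable G_groupoid)) (gtop G_groupoid)
      (\<lambda>(g, h). gcomp G_groupoid g h)"
    using f(3) unfolding continuous_map_into_G by (auto intro: continuous_map_from_subtopology)
qed

text \<open>G is the zero set of a map into a discrete space, hence closed in the product of a
  discrete and a compact space.\<close>

lemma locally_compact_space_G: "locally_compact_space (gtop G_groupoid)"
proof -
  let ?P = "prod_topology (discrete_topology {0<..}) zhat_topology :: (rat \<times> zhat) topology"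
  have "continuous_map ?P (discrete_topology UNIV) (\<lambda>g. zhat_app (snd g) (mk_qz (fst g)))"
    by (intro continuous_map_prod_discrete) (simp add: continuous_map_zhat_app)
  then have "closedin ?P {g \<in> topspace ?P. zhat_app (snd g) (mk_qz (fst g)) \<in> {0}}"
    by (rule closedin_continuous_map_preimage) auto
  moreover have "{g \<in> topspace ?P. zhat_app (snd g) (mk_qz (fst g)) \<in> {0}} = G_arrows"
    by (auto simp: G_arrows_iff)
  ultimately show ?thesis unfolding gtop_G
    by (intro locally_compact_space_closed_subset)
      (auto simp: locally_compact_space_prod_topology locally_compact_space_discrete_topology
        compact_imp_locally_compact_space compact_space_zhat)
qed

lemma Hausdorff_space_G: "Hausdorff_space (gtop G_groupoid)"
  unfolding gtop_G
  by (intro Hausdorff_space_subtopology) (simp add: Hausdorff_space_prod_topology Hausdorff_space_zhat)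

text \<open>On the image of U under a, the map f' is the inverse of a followed by f and b. This
  serves twice: to get the range map from the source map, and to move the etale property along an
  isomorphism.\<close>

lemma local_homeomorphism_conjugate:
  assumes f: "local_homeomorphism X Y f"
    and a: "homeomorphic_map X X' a" and b: "homeomorphic_map Y Y' b"
    and eq: "\<And>x. x \<in> topspace X \<Longrightarrow> f' (a x) = b (f x)"
  shows "local_homeomorphism X' Y' f'"
proof -
  obtain a' where a': "homeomorphic_maps X X' a a'" using a homeomorphic_map_maps by blast
  have surj: "topspace X' = a ` topspace X" "topspace Y' = b ` topspace Y"
    using a b by (simp_all add: homeomorphic_imp_surjective_map)
  have fY: "f \<in> topspace X \<rightarrow> topspace Y" using f by (simp add: local_homeomorphism_def)
  have "\<exists>V. openin X' V \<and> a x \<in> V \<and> openin Y' (f' ` V) \<and>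
        homeomorphic_map (subtopology X' V) (subtopology Y' (f' ` V)) f'"
    if x: "x \<in> topspace X" for x
  proof -
    obtain U where U: "openin X U" "x \<in> U" "openin Y (f ` U)"
      "homeomorphic_map (subtopology X U) (subtopology Y (f ` U)) f"
      using f x unfolding local_homeomorphism_def by blast
    have sub: "U \<subseteq> topspace X" "f ` U \<subseteq> topspace Y" using U openin_subset by blast+
    have V: "f' ` a ` U = b ` f ` U" using sub eq by (force simp: image_image)
    have "homeomorphic_map (subtopology X U) (subtopology X' (a ` U)) a"
      using sub surj by (intro homeomorphic_map_subtopologies[OF a]) auto
    then obtain k where k: "homeomorphic_maps (subtopology X U) (subtopology X' (a ` U)) a k"
      using homeomorphic_map_maps by blast
    then have kh: "homeomorphic_map (subtopology X' (a ` U)) (subtopology X U) k"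
      using homeomorphic_maps_map by blast
    have bh: "homeomorphic_map (subtopology Y (f ` U)) (subtopology Y' (b ` f ` U)) b"
      using sub surj by (intro homeomorphic_map_subtopologies[OF b]) auto
    have "homeomorphic_map (subtopology X' (a ` U)) (subtopology Y' (b ` f ` U)) (b \<circ> (f \<circ> k))"
      by (intro homeomorphic_map_compose[OF homeomorphic_map_compose[OF kh U(4)] bh])
    moreover have "(b \<circ> (f \<circ> k)) y = f' y" if "y \<in> topspace (subtopology X' (a ` U))" for y
      using that k sub unfolding homeomorphic_maps_def by (auto simp: eq)
    ultimately have "homeomorphic_map (subtopology X' (a ` U)) (subtopology Y' (f' ` a ` U)) f'"
      unfolding V using homeomorphic_map_eq by blast
    moreover have "openin X' (a ` U)" "openin Y' (f' ` a ` U)"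
      unfolding V using a b U by (simp_all add: homeomorphic_map_openness_eq)
    ultimately show ?thesis using U(2) by blast
  qed
  then show ?thesis using fY eq unfolding local_homeomorphism_def surj by auto
qed

text \<open>The arrows with a fixed r form an open slice. The source map sends it onto the units (1,
  \<sigma>) with \<sigma> zero at r, an open set of units, and the inverse sends (1, \<sigma>) to
  (r, \<sigma>).\<close>

lemma local_homeomorphism_gsource_G:
  "local_homeomorphism (gtop G_groupoid) (subtopology (gtop G_groupoid) (gunits G_groupoid)) (gsource G_groupoid)"
  (is "local_homeomorphism ?X ?Y ?f")
proof -
  have cts: "continuous_map ?X ?Y ?f"
  proof -
    have "continuous_map ?X (discrete_topology UNIV) (fst \<circ> ?f)"
      by (rule continuous_map_eq[of _ _ "\<lambda>_. 1"]) (auto simp: gsource_G)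
    moreover have "continuous_map ?X zhat_topology (snd \<circ> ?f)"
      by (rule continuous_map_eq[OF continuous_map_snd_G]) (auto simp: gsource_G)
    ultimately show ?thesis
      by (auto simp: continuous_map_in_subtopology continuous_map_into_G gsource_G gunits_G)
  qed
  have "\<exists>U. openin ?X U \<and> (r, \<rho>) \<in> U \<and> openin ?Y (?f ` U) \<and>
        homeomorphic_map (subtopology ?X U) (subtopology ?Y (?f ` U)) ?f"
    if g: "(r, \<rho>) \<in> G_arrows" for r \<rho>
  proof -
    define U where "U = {g \<in> topspace ?X. fst g \<in> {r}}"
    have U: "openin ?X U" unfolding U_def
      by (rule openin_continuous_map_preimage[OF continuous_map_fst_G]) auto
    have fU: "?f ` U = {1} \<times> {\<sigma>. zhat_app \<sigma> (mk_qz r) = 0}"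
    proof -
      have "(1, \<sigma>) \<in> ?f ` U" if "zhat_app \<sigma> (mk_qz r) = 0" for \<sigma>
        by (rule image_eqI[of _ _ "(r, \<sigma>)"]) (use g that in \<open>auto simp: gsource_G U_def G_arrows_iff\<close>)
      then show ?thesis by (auto simp: U_def gsource_G) (simp add: G_arrows_iff)
    qed
    have "openin ?X {g \<in> topspace ?X. zhat_app (snd g) (mk_qz r) \<in> {0}}"
      by (rule openin_continuous_map_preimage[OF continuous_map_eval_G[of "\<lambda>_. r"]]) auto
    then have "openin ?Y (gunits G_groupoid \<inter> {g \<in> topspace ?X. zhat_app (snd g) (mk_qz r) \<in> {0}})"
      by (simp add: openin_subtopology_Int2)
    moreover have "gunits G_groupoid \<inter> {g \<in> topspace ?X. zhat_app (snd g) (mk_qz r) \<in> {0}} = ?f ` U"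
      unfolding fU gunits_G by auto
    ultimately have V: "openin ?Y (?f ` U)" by simp
    have "homeomorphic_maps (subtopology ?X U) (subtopology ?Y (?f ` U)) ?f (\<lambda>g. (r, snd g))"
      unfolding homeomorphic_maps_def
    proof (intro conjI)
      show "continuous_map (subtopology ?X U) (subtopology ?Y (?f ` U)) ?f"
        using cts by (auto simp: continuous_map_in_subtopology continuous_map_from_subtopology)
      show "continuous_map (subtopology ?Y (?f ` U)) (subtopology ?X U) (\<lambda>g. (r, snd g))"
        unfolding continuous_map_in_subtopology continuous_map_into_G fU
      proof (intro conjI)
        show "continuous_map (subtopology ?Y ({1} \<times> {\<sigma>. zhat_app \<sigma> (mk_qz r) = 0})) zhat_topology
            (snd \<circ> (\<lambda>g. (r, snd g)))"
          by (simp add: comp_def continuous_map_from_subtopology continuous_map_snd_G)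
      qed (use g in \<open>auto simp: U_def comp_def G_arrows_iff\<close>)
      show "\<forall>x\<in>topspace (subtopology ?X U). (r, snd (?f x)) = x"
        by (auto simp: U_def gsource_G)
      show "\<forall>y\<in>topspace (subtopology ?Y (?f ` U)). ?f (r, snd y) = y"
        unfolding fU using g by (auto simp: gsource_G G_arrows_iff)
    qed
    then show ?thesis using U V g by (auto simp: homeomorphic_map_maps U_def intro!: exI[of _ U])
  qed
  then show ?thesis using continuous_map_funspace[OF cts] by (auto simp: local_homeomorphism_def)
qed

lemma lc_etale_groupoid_G: "lc_etale_groupoid G_groupoid"
  unfolding lc_etale_groupoid_def
proof (intro conjI is_top_groupoid_G locally_compact_space_G Hausdorff_space_G local_homeomorphism_gsource_G)
  \<comment> \<open>The range of an arrow is the source of its inverse. As inversion is a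
    homeomorphism, the range map inherits the property from the source map.\<close>
  have inv: "ginv G_groupoid (ginv G_groupoid g) = g" if "g \<in> G_arrows" for g
    using that is_groupoid_G by (simp add: is_groupoid_def)
  then have "homeomorphic_maps (gtop G_groupoid) (gtop G_groupoid) (ginv G_groupoid) (ginv G_groupoid)"
    by (simp add: homeomorphic_maps_def continuous_map_ginv_G)
  then have "homeomorphic_map (gtop G_groupoid) (gtop G_groupoid) (ginv G_groupoid)"
    using homeomorphic_map_maps by blast
  then show "local_homeomorphism (gtop G_groupoid)
      (subtopology (gtop G_groupoid) (gunits G_groupoid)) (grange G_groupoid)"
    by (rule local_homeomorphism_conjugate[OF local_homeomorphism_gsource_G, where b = id])
      (use inv in \<open>auto simp: grange_def gsource_def\<close>)
qed

section \<open>Transport of locally compact etale groupoids along an isomorphism\<close>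

text \<open>\<open>top_groupoid_iso\<close> speaks only of images of arrows and of products. The two
  further assumptions confine composability in H to arrows and make its inverse the one carried over
  from G.\<close>

lemma lc_etale_groupoid_transfer:
  assumes G: "lc_etale_groupoid G" and f: "top_groupoid_iso G H f"
    and comp: "composable H \<subseteq> topspace (gtop H) \<times> topspace (gtop H)"
    and inv: "\<And>g. g \<in> topspace (gtop G) \<Longrightarrow> ginv H (f g) = f (ginv G g)"
  shows "lc_etale_groupoid H"
proof -
  have hom: "homeomorphic_map (gtop G) (gtop H) f" using f by (simp add: top_groupoid_iso_def)
  then have surj: "topspace (gtop H) = f ` topspace (gtop G)"
    by (simp add: homeomorphic_imp_surjective_map)
  obtain k where k: "homeomorphic_maps (gtop G) (gtop H) f k" using hom homeomorphic_map_maps by blast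
  have kf: "k (f g) = g" if "g \<in> topspace (gtop G)" for g
    using k that by (simp add: homeomorphic_maps_def)
  have gr: "is_groupoid G" using G by (simp add: lc_etale_groupoid_def is_top_groupoid_def)
  have gmem: "g \<in> topspace (gtop G)" "h \<in> topspace (gtop G)" "gcomp G g h \<in> topspace (gtop G)"
    if "(g, h) \<in> composable G" for g h
    using gr that by (auto simp: is_groupoid_def)
  have ginvmem: "ginv G g \<in> topspace (gtop G)" "(g, ginv G g) \<in> composable G"
    "ginv G (ginv G g) = g" if "g \<in> topspace (gtop G)" for g
    using gr that by (auto simp: is_groupoid_def)
  have ginvmem': "(ginv G g, g) \<in> composable G" if "g \<in> topspace (gtop G)" for g
    using ginvmem(2)[OF ginvmem(1)[OF that]] ginvmem(3)[OF that] by simp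
  have fc: "(f g, f h) \<in> composable H \<longleftrightarrow> (g, h) \<in> composable G"
    if "g \<in> topspace (gtop G)" "h \<in> topspace (gtop G)" for g h
    using f that by (simp add: top_groupoid_iso_def)
  have fm: "gcomp H (f g) (f h) = f (gcomp G g h)" if "(g, h) \<in> composable G" for g h
    using f that by (auto simp: top_groupoid_iso_def)
  \<comment> \<open>Every composable pair of H is the image of a composable pair of G, so the axioms
    can be checked in G.\<close>
  have cE: "\<exists>g h. p = f g \<and> q = f h \<and> (g, h) \<in> composable G" if "(p, q) \<in> composable H" for p q
    using that comp fc unfolding surj by blast
  have grH: "is_groupoid H"
    unfolding is_groupoid_def
  proof (intro conjI allI impI)
    have "gcomp H p q \<in> topspace (gtop H)" if pq: "(p, q) \<in> composable H" for p q
    proof -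
      obtain g h where "p = f g" "q = f h" "(g, h) \<in> composable G" using cE[OF pq] by blast
      then show ?thesis by (simp add: fm gmem surj)
    qed
    then show "\<forall>(g, h)\<in>composable H. gcomp H g h \<in> topspace (gtop H)" by blast
  next
    fix p q s assume "(p, q) \<in> composable H" and qs: "(q, s) \<in> composable H"
    then obtain g h where gh: "p = f g" "q = f h" "(g, h) \<in> composable G" using cE by blast
    obtain j where j: "s = f j" "j \<in> topspace (gtop G)" using qs comp surj by blast
    have hj: "(h, j) \<in> composable G" using qs fc gh j gmem by blast
    have a: "(gcomp G g h, j) \<in> composable G" "(g, gcomp G h j) \<in> composable G"
        "gcomp G (gcomp G g h) j = gcomp G g (gcomp G h j)"
      using gr gh(3) hj unfolding is_groupoid_def by blast+
    show "(gcomp H p q, s) \<in> composable H" "(p, gcomp H q s) \<in> composable H"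
      "gcomp H (gcomp H p q) s = gcomp H p (gcomp H q s)"
      using a gh hj j by (simp_all add: fm fc gmem)
  next
    show "\<forall>g\<in>topspace (gtop H). ginv H g \<in> topspace (gtop H) \<and> ginv H (ginv H g) = g \<and> (g, ginv H g) \<in> composable H"
      unfolding surj by (auto simp: inv ginvmem fc)
  next
    have "gcomp H (ginv H p) (gcomp H p q) = q \<and> gcomp H (gcomp H p q) (ginv H q) = p"
      if pq: "(p, q) \<in> composable H" for p q
    proof -
      obtain g h where gh: "p = f g" "q = f h" "(g, h) \<in> composable G" using cE pq by blast
      have ax: "gcomp G (ginv G g) (gcomp G g h) = h" "gcomp G (gcomp G g h) (ginv G h) = g"
        using gr gh(3) unfolding is_groupoid_def by auto
      have "(ginv G g, gcomp G g h) \<in> composable G" "(gcomp G g h, ginv G h) \<in> composable G"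
        using gr gh(3) ginvmem' ginvmem(2) gmem[OF gh(3)] unfolding is_groupoid_def by blast+
      then show ?thesis using gh gmem[OF gh(3)] by (simp add: fm inv ax)
    qed
    then show "\<forall>(g, h)\<in>composable H.
        gcomp H (ginv H g) (gcomp H g h) = h \<and> gcomp H (gcomp H g h) (ginv H h) = g" by auto
  qed (use comp in auto)
  have kc: "continuous_map (gtop H) (gtop G) k" and fcont: "continuous_map (gtop G) (gtop H) f"
    using k by (simp_all add: homeomorphic_maps_def)
  have topH: "is_top_groupoid H"
    unfolding is_top_groupoid_def
  proof (intro conjI grH)
    have "continuous_map (gtop H) (gtop H) (f \<circ> ginv G \<circ> k)"
      using G by (intro continuous_map_compose[OF kc] continuous_map_compose[OF _ fcont])
        (auto simp: lc_etale_groupoid_def is_top_groupoid_def)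
    then show "continuous_map (gtop H) (gtop H) (ginv H)"
      by (rule continuous_map_eq) (auto simp: surj inv kf)
  next
    let ?PG = "subtopology (prod_topology (gtop G) (gtop G)) (composable G)"
    let ?PH = "subtopology (prod_topology (gtop H) (gtop H)) (composable H)"
    have "continuous_map (prod_topology (gtop H) (gtop H)) (prod_topology (gtop G) (gtop G)) (\<lambda>(p, q). (k p, k q))"
      using kc by (simp add: continuous_map_prod_top)
    moreover have "(k p, k q) \<in> composable G" if "(p, q) \<in> composable H" for p q
      using cE[OF that] gmem kf by auto
    ultimately have "continuous_map ?PH ?PG (\<lambda>(p, q). (k p, k q))"
      by (auto simp: continuous_map_in_subtopology continuous_map_from_subtopology)
    moreover have "continuous_map ?PG (gtop G) (\<lambda>(g, h). gcomp G g h)"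
      using G by (auto simp: lc_etale_groupoid_def is_top_groupoid_def)
    \<comment> \<open>Composition in H is k in both arguments, then composition in G, then
      f.\<close>
    ultimately have "continuous_map ?PH (gtop H) (f \<circ> ((\<lambda>(g, h). gcomp G g h) \<circ> (\<lambda>(p, q). (k p, k q))))"
      using fcont by (blast intro: continuous_map_compose)
    moreover have "(f \<circ> ((\<lambda>(g, h). gcomp G g h) \<circ> (\<lambda>(p, q). (k p, k q)))) z = (\<lambda>(g, h). gcomp H g h) z"
      if "z \<in> topspace ?PH" for z
    proof -
      obtain p q where z: "z = (p, q)" by fastforce
      then have "(p, q) \<in> composable H" using that by simp
      then obtain g h where "p = f g" "q = f h" "(g, h) \<in> composable G" using cE by blast
      then show ?thesis using z by (simp add: fm kf gmem)
    qed
    ultimately show "continuous_map ?PH (gtop H) (\<lambda>(g, h). gcomp H g h)"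
      by (rule continuous_map_eq)
  qed
  have range: "grange H (f g) = f (grange G g)" if "g \<in> topspace (gtop G)" for g
    using that by (simp add: grange_def inv fm ginvmem)
  have source: "gsource H (f g) = f (gsource G g)" if "g \<in> topspace (gtop G)" for g
    using that by (simp add: gsource_def inv fm ginvmem')
  have units: "gunits H = f ` gunits G" by (auto simp: gunits_def surj range image_image)
  have "gunits G \<subseteq> topspace (gtop G)" by (auto simp: gunits_def grange_def gmem ginvmem)
  then have uh: "homeomorphic_map (subtopology (gtop G) (gunits G)) (subtopology (gtop H) (gunits H)) f"
    using surj units by (intro homeomorphic_map_subtopologies[OF hom]) auto
  have "gtop G homeomorphic_space gtop H" using k homeomorphic_space_def by blast
  then have "locally_compact_space (gtop H)" "Hausdorff_space (gtop H)"
    using G homeomorphic_locally_compact_space homeomorphic_Hausdorff_space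
    by (auto simp: lc_etale_groupoid_def)
  moreover have "local_homeomorphism (gtop H) (subtopology (gtop H) (gunits H)) (grange H)"
    by (rule local_homeomorphism_conjugate[where f = "grange G", OF _ hom uh])
      (use G range in \<open>auto simp: lc_etale_groupoid_def\<close>)
  moreover have "local_homeomorphism (gtop H) (subtopology (gtop H) (gunits H)) (gsource H)"
    by (rule local_homeomorphism_conjugate[where f = "gsource G", OF _ hom uh])
      (use G source in \<open>auto simp: lc_etale_groupoid_def\<close>)
  ultimately show ?thesis using topH by (simp add: lc_etale_groupoid_def)
qed

section \<open>Lattices in the line\<close>

lemma mem_elt_times_Ints: "x \<in> c *o (\<int> :: real set) \<longleftrightarrow> (\<exists>n. x = c * of_int n)"
  by (auto simp: elt_set_times_def elim!: Ints_cases)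

lemma Ints_multiples_add: "x \<in> c *o \<int> \<Longrightarrow> y \<in> c *o \<int> \<Longrightarrow> x + y \<in> c *o (\<int> :: real set)"
  and Ints_multiples_diff: "x \<in> c *o \<int> \<Longrightarrow> y \<in> c *o \<int> \<Longrightarrow> x - y \<in> c *o (\<int> :: real set)"
  unfolding mem_elt_times_Ints
  by (metis distrib_left of_int_add, metis right_diff_distrib of_int_diff)

text \<open>This is division with remainder by c, and it makes [0, c) a fundamental domain for the
  multiples of c.\<close>

lemma floor_divide_eq_iff:
  fixes c x :: real
  assumes "c > 0"
  shows "\<lfloor>x / c\<rfloor> = n \<longleftrightarrow> x - c * of_int n \<in> {0..<c}"
  using assms by (auto simp: floor_eq_iff field_simps)

text \<open>The generator is the least positive element: cocompactness provides a positive element,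
  discreteness makes the infimum attained, and division with remainder leaves only its
  multiples.\<close>

lemma is_lattice_iff: "is_lattice \<Lambda> \<longleftrightarrow> (\<exists>c>0. \<Lambda> = c *o \<int>)"
proof
  assume "\<exists>c>0. \<Lambda> = c *o \<int>"
  then obtain c where c: "c > 0" and \<Lambda>: "\<Lambda> = c *o \<int>" by blast
  have "x isolated_in \<Lambda>" if x: "x \<in> \<Lambda>" for x
    unfolding isolated_in_dist_Ex_iff
  proof (intro conjI x exI[of _ c] ballI impI c)
    fix y assume "y \<in> \<Lambda>" and d: "dist x y < c"
    then obtain m n where mn: "x = c * of_int m" "y = c * of_int n"
      using x unfolding \<Lambda> mem_elt_times_Ints by blast
    then have "dist x y = c * of_int \<bar>m - n\<bar>"
      using c by (simp add: dist_real_def abs_mult flip: right_diff_distrib)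
    then have "of_int \<bar>m - n\<bar> < (1::real)" using d c by simp
    then have "\<bar>m - n\<bar> < 1" by linarith
    then show "y = x" using mn by simp
  qed
  then have "discrete \<Lambda>" by (rule discreteI)
  moreover have "{0..c} + \<Lambda> = UNIV"
  proof (intro equalityI subset_UNIV subsetI)
    fix x :: real
    have "x - c * of_int \<lfloor>x / c\<rfloor> \<in> {0..c}" using floor_divide_eq_iff[OF c, of x] by force
    moreover have "c * of_int \<lfloor>x / c\<rfloor> \<in> \<Lambda>" unfolding \<Lambda> mem_elt_times_Ints by blast
    ultimately have "x - c * of_int \<lfloor>x / c\<rfloor> + c * of_int \<lfloor>x / c\<rfloor> \<in> {0..c} + \<Lambda>"
      by (rule set_plus_intro)
    then show "x \<in> {0..c} + \<Lambda>" by simp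
  qed
  moreover have "0 \<in> \<Lambda>" unfolding \<Lambda> mem_elt_times_Ints by (rule exI[of _ 0]) simp
  ultimately show "is_lattice \<Lambda>"
    unfolding is_lattice_def using Ints_multiples_diff[of _ c] compact_Icc \<Lambda> by blast
next
  assume "is_lattice \<Lambda>"
  then have 0: "0 \<in> \<Lambda>" and diff: "\<And>x y. x \<in> \<Lambda> \<Longrightarrow> y \<in> \<Lambda> \<Longrightarrow> x - y \<in> \<Lambda>"
    and disc: "discrete \<Lambda>" and "\<exists>K. compact K \<and> K + \<Lambda> = UNIV"
    by (auto simp: is_lattice_def)
  then obtain K where K: "compact K" "K + \<Lambda> = UNIV" by blast
  have neg: "- x \<in> \<Lambda>" if "x \<in> \<Lambda>" for x using diff[OF 0 that] by simp
  have add: "x + y \<in> \<Lambda>" if "x \<in> \<Lambda>" "y \<in> \<Lambda>" for x y using diff[OF that(1) neg[OF that(2)]] by simp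
  obtain e where e: "e > 0" "\<And>y. y \<in> \<Lambda> \<Longrightarrow> \<bar>y\<bar> < e \<Longrightarrow> y = 0"
    using discreteD[OF disc 0] unfolding isolated_in_dist_Ex_iff by (auto simp: dist_real_def)
  have "\<exists>x\<in>\<Lambda>. x > 0"
  proof (rule ccontr)
    assume none: "\<not> ?thesis"
    have "x = 0" if "x \<in> \<Lambda>" for x
      using none that neg[OF that] by (metis linorder_neqE_linordered_idom neg_0_less_iff_less)
    \<comment> \<open>If 0 were the only element, the compact set \<open>K\<close> alone would be
      the whole line.\<close>
    then have "\<Lambda> = {0}" using 0 by blast
    then have "K = UNIV" using K(2) by (auto simp: set_plus_def)
    then show False using K(1) not_bounded_UNIV compact_imp_bounded by blast
  qed
  define P where "P = {x \<in> \<Lambda>. x > 0}"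
  define c where "c = Inf P"
  have "P \<noteq> {}" using \<open>\<exists>x\<in>\<Lambda>. x > 0\<close> by (auto simp: P_def)
  have Pe: "e \<le> x" if "x \<in> P" for x using that e(2)[of x] by (force simp: P_def)
  then have bdd: "bdd_below P" by (auto simp: bdd_below_def)
  have ec: "e \<le> c" unfolding c_def using \<open>P \<noteq> {}\<close> Pe by (rule cInf_greatest)
  then have c: "c > 0" using e by simp
  have "c \<in> \<Lambda>"
  proof (rule ccontr)
    \<comment> \<open>Were the infimum not attained, two distinct elements of \<open>P\<close> would
      lie in [c, c + e), and their difference would be a nonzero element of size below e.\<close>
    assume "c \<notin> \<Lambda>"
    obtain x where x: "x \<in> P" "x < c + e"
      using cInf_lessD[OF \<open>P \<noteq> {}\<close>, of "c + e"] e(1) by (auto simp: c_def)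
    have "c \<le> x" unfolding c_def using x(1) bdd by (rule cInf_lower)
    then have "c < x" using \<open>c \<notin> \<Lambda>\<close> x(1) by (cases "c = x") (auto simp: P_def)
    then obtain y where y: "y \<in> P" "y < x"
      using cInf_lessD[OF \<open>P \<noteq> {}\<close>, of x] by (auto simp: c_def)
    have "c \<le> y" unfolding c_def using y(1) bdd by (rule cInf_lower)
    then have "\<bar>x - y\<bar> < e" using x y by simp
    then show False using e(2)[of "x - y"] diff[of x y] x y by (auto simp: P_def)
  qed
  have mult: "c * of_int n \<in> \<Lambda>" for n
  proof -
    have nat: "c * of_nat k \<in> \<Lambda>" for k
      by (induction k) (auto simp: 0 algebra_simps intro: add \<open>c \<in> \<Lambda>\<close>)
    show ?thesis using nat[of "nat n"] neg[OF nat[of "nat (- n)"]] by (cases "n \<ge> 0") auto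
  qed
  have "x \<in> c *o \<int>" if x: "x \<in> \<Lambda>" for x
  proof -
    define y where "y = x - c * of_int \<lfloor>x / c\<rfloor>"
    have y: "0 \<le> y" "y < c" using floor_divide_eq_iff[OF c, of x "\<lfloor>x / c\<rfloor>"] by (simp_all add: y_def)
    have "y \<in> \<Lambda>" unfolding y_def by (intro diff x mult)
    have "y = 0"
    proof (rule ccontr)
      assume "y \<noteq> 0"
      then have "y \<in> P" using y \<open>y \<in> \<Lambda>\<close> by (simp add: P_def)
      then show False using cInf_lower[OF _ bdd, of y] y by (simp add: c_def)
    qed
    then show ?thesis unfolding mem_elt_times_Ints y_def by (intro exI[of _ "\<lfloor>x / c\<rfloor>"]) simp
  qed
  then have "\<Lambda> = c *o \<int>" using mult mem_elt_times_Ints by auto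
  then show "\<exists>c>0. \<Lambda> = c *o \<int>" using c by blast
qed

section \<open>Covolumes\<close>

lemma emeasure_lborel_vimage_plus:
  fixes A :: "real set"
  assumes "A \<in> sets borel"
  shows "emeasure lborel ((+) a -` A) = emeasure lborel A"
proof -
  have "emeasure lborel A = emeasure (distr lborel borel ((+) a)) A" by (simp add: lborel_distr_plus)
  also have "\<dots> = emeasure lborel ((+) a -` A)" using assms by (simp add: emeasure_distr)
  finally show ?thesis by simp
qed

text \<open>Cut \<open>F\<close> along the translates of \<open>D\<close>; the pieces reassemble to \<open>D\<close> by translations.\<close>

lemma emeasure_fundamental_domain_unique:
  fixes F D \<Lambda> :: "real set"
  assumes "countable \<Lambda>" "F \<in> sets borel" "D \<in> sets borel"
    and F: "\<And>x. \<exists>!l. l \<in> \<Lambda> \<and> x - l \<in> F" and D: "\<And>x. \<exists>!l. l \<in> \<Lambda> \<and> x - l \<in> D"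
    and neg: "\<And>x. x \<in> \<Lambda> \<Longrightarrow> - x \<in> \<Lambda>"
  shows "emeasure lborel F = emeasure lborel D"
proof -
  define A where "A l = {x \<in> F. x - l \<in> D}" for l
  define B where "B l = {x \<in> D. x + l \<in> F}" for l
  have tr: "(\<lambda>x. x + a) -` S \<in> sets borel" if "S \<in> sets borel" for a :: real and S
    using measurable_sets_borel[of "\<lambda>x. x + a" borel S] that by simp
  have A: "A l \<in> sets borel" for l
  proof -
    have "A l = F \<inter> (\<lambda>x. x + (- l)) -` D" by (auto simp: A_def)
    then show ?thesis using assms tr by auto
  qed
  have B: "B l \<in> sets borel" for l
  proof -
    have "B l = D \<inter> (\<lambda>x. x + l) -` F" by (auto simp: B_def)
    then show ?thesis using assms tr by auto
  qed
  have "\<exists>l\<in>\<Lambda>. x - l \<in> D" for x using D[of x] by blast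
  then have "F = (\<Union>l\<in>\<Lambda>. A l)" by (auto simp: A_def)
  moreover have "disjoint_family_on A \<Lambda>" using D unfolding disjoint_family_on_def A_def by blast
  ultimately have "emeasure lborel F = (\<integral>\<^sup>+l. emeasure lborel (A l) \<partial>count_space \<Lambda>)"
    using emeasure_UN_countable[of \<Lambda> A lborel] A assms(1) by simp
  also have "\<dots> = (\<integral>\<^sup>+l. emeasure lborel (B l) \<partial>count_space \<Lambda>)"
  proof (rule nn_integral_cong)
    fix l
    have "B l = (+) l -` A l" by (auto simp: A_def B_def add.commute)
    then show "emeasure lborel (A l) = emeasure lborel (B l)"
      using emeasure_lborel_vimage_plus[OF A] by simp
  qed
  also have "\<dots> = emeasure lborel D"
  proof -
    \<comment> \<open>The element of \<Lambda> that moves x into \<open>F\<close> enters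
      \<open>B\<close> with the opposite sign, which is where closure under negation comes
      in.\<close>
    have "x \<in> (\<Union>l\<in>\<Lambda>. B l)" if "x \<in> D" for x
      using F[of x] neg that unfolding B_def by force
    then have "D = (\<Union>l\<in>\<Lambda>. B l)" by (auto simp: B_def)
    moreover have "disjoint_family_on B \<Lambda>" unfolding disjoint_family_on_def
    proof (intro ballI impI)
      fix l m assume lm: "l \<in> \<Lambda>" "m \<in> \<Lambda>" "l \<noteq> m"
      show "B l \<inter> B m = {}"
      proof (rule ccontr)
        assume "B l \<inter> B m \<noteq> {}"
        then obtain x where "x - (- l) \<in> F" "x - (- m) \<in> F" by (auto simp: B_def)
        then have "- l = - m" using F[of x] neg lm by blast
        then show False using lm by simp
      qed
    qed
    ultimately show ?thesis
      using emeasure_UN_countable[of \<Lambda> B lborel] B assms(1) by simp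
  qed
  finally show ?thesis .
qed

text \<open>\<open>covolume\<close> measures a fundamental domain picked by \<open>SOME\<close>; any
  two have the same measure, so [0, c) can stand in for it.\<close>

lemma covolume_multiples:
  assumes c: "c > 0"
  shows "covolume (c *o \<int>) = c"
proof -
  let ?L = "c *o (\<int> :: real set)"
  let ?fd = "\<lambda>F. F \<in> sets borel \<and> (\<forall>x. \<exists>!l. l \<in> ?L \<and> x - l \<in> F)"
  have fd: "?fd {0..<c}"
  proof (intro conjI allI)
    fix x :: real
    show "\<exists>!l. l \<in> ?L \<and> x - l \<in> {0..<c}"
      unfolding mem_elt_times_Ints
      by (intro ex1I[of _ "c * of_int \<lfloor>x / c\<rfloor>"]) (auto simp: floor_divide_eq_iff[OF c, symmetric] simp del: atLeastLessThan_iff)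
  qed simp
  define F where "F = (SOME F. ?fd F)"
  have F: "?fd F" unfolding F_def by (rule someI[of ?fd, OF fd])
  have "countable ?L"
  proof (rule countable_subset)
    show "?L \<subseteq> range (\<lambda>n::int. c * of_int n)" by (auto simp: mem_elt_times_Ints image_iff)
  qed simp
  moreover have "- x \<in> ?L" if "x \<in> ?L" for x
    using that unfolding mem_elt_times_Ints by (metis mult_minus_right of_int_minus)
  ultimately have "emeasure lborel F = emeasure lborel {0..<c}"
    using F fd by (intro emeasure_fundamental_domain_unique[of ?L]) auto
  then show ?thesis using c by (simp add: covolume_def measure_def flip: F_def)
qed

lemma Ints_multiples_inj: "c > 0 \<Longrightarrow> d > 0 \<Longrightarrow> c *o \<int> = d *o (\<int> :: real set) \<longleftrightarrow> c = d"
  using covolume_multiples by metis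

section \<open>Coordinates on the space of Q-lattices\<close>

definition qlat :: "real \<Rightarrow> zhat \<Rightarrow> q_lattice" where
  "qlat c \<rho> = scale_lattice c (integer_lattice \<rho>)"

lemma fst_qlat [simp]: "fst (qlat c \<rho>) = c *o \<int>"
  by (simp add: qlat_def scale_lattice_def integer_lattice_def)

lemma scale_lattice_qlat [simp]: "scale_lattice a (qlat c \<rho>) = qlat (a * c) \<rho>"
  by (simp add: qlat_def scale_lattice_def integer_lattice_def set_times_rearrange2)

lemma integer_lattice_eq_qlat: "integer_lattice \<rho> = qlat 1 \<rho>"
  by (simp add: qlat_def scale_lattice_def integer_lattice_def elt_set_times_def)

lemma mem_coset_iff:
  "x \<in> (c * of_rat p) +o (c *o \<int>) \<longleftrightarrow> (\<exists>n. x = c * (of_rat p + of_int n :: real))"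
  by (auto simp: elt_set_plus_def mem_elt_times_Ints distrib_left)

text \<open>A rational representative p of the value of \<rho> makes the label an explicit coset of
  reals.\<close>

lemma snd_qlat:
  assumes "zhat_app \<rho> x = mk_qz p"
  shows "snd (qlat c \<rho>) x = (c * of_rat p) +o (c *o \<int>)"
proof -
  have "qz_coset (mk_qz p) = range (\<lambda>n. of_rat p + of_int n)"
  proof (intro set_eqI iffI)
    fix t assume "t \<in> qz_coset (mk_qz p)"
    then obtain q where q: "t = of_rat q" "q - p \<in> \<int>" by (auto simp: qz_coset_def qz.abs_eq_iff)
    then obtain n where "q = p + of_int n" by (auto simp: algebra_simps elim: Ints_cases)
    then show "t \<in> range (\<lambda>n. of_rat p + of_int n)" using q by (simp add: of_rat_add)
  next
    fix t :: real assume "t \<in> range (\<lambda>n. of_rat p + of_int n)"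
    then obtain n where "t = of_rat (p + of_int n)" by (auto simp: of_rat_add)
    then show "t \<in> qz_coset (mk_qz p)" by (auto simp: qz_coset_def qz.abs_eq_iff)
  qed
  then have "snd (qlat c \<rho>) x = c *o range (\<lambda>n. of_rat p + of_int n)"
    by (simp add: qlat_def scale_lattice_def integer_lattice_def assms)
  then show ?thesis by (simp add: set_eq_iff mem_coset_iff) (auto simp: elt_set_times_def)
qed

lemma of_rat_diff_Ints_iff: "(of_rat x :: real) \<in> \<int> \<longleftrightarrow> x \<in> \<int>"
  by (metis Ints_cases Ints_of_int of_rat_eq_iff of_rat_of_int_eq)

text \<open>Multiplication by c embeds Q/Z into the real line modulo the multiples of c.\<close>

lemma coset_eq_iff:
  assumes "c > 0"
  shows "(c * of_rat p) +o (c *o \<int>) = (c * of_rat q) +o (c *o (\<int> :: real set)) \<longleftrightarrow> mk_qz p = mk_qz q"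
proof
  assume eq: "(c * of_rat p) +o (c *o \<int>) = (c * of_rat q) +o (c *o (\<int> :: real set))"
  have "c * of_rat p \<in> (c * of_rat p) +o (c *o \<int>)"
    unfolding mem_coset_iff by (rule exI[of _ 0]) simp
  then obtain n where "c * of_rat p = c * (of_rat q + of_int n)"
    unfolding eq mem_coset_iff by blast
  then have "of_rat (p - q) = (of_int n :: real)" using assms by (simp add: of_rat_diff)
  then show "mk_qz p = mk_qz q" unfolding qz.abs_eq_iff by (metis Ints_of_int of_rat_diff_Ints_iff)
next
  assume "mk_qz p = mk_qz q"
  then obtain n where n: "p = q + of_int n"
    unfolding qz.abs_eq_iff by (auto simp: algebra_simps elim: Ints_cases)
  have "(\<exists>m. x = c * (of_rat p + of_int m)) \<longleftrightarrow> (\<exists>m. x = c * (of_rat q + of_int m))" for x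
  proof safe
    fix m show "\<exists>k. c * (of_rat p + of_int m) = c * (of_rat q + of_int k)"
      by (rule exI[of _ "m + n"]) (simp add: n of_rat_add)
  next
    fix m show "\<exists>k. c * (of_rat q + of_int m) = c * (of_rat p + of_int k)"
      by (rule exI[of _ "m - n"]) (simp add: n of_rat_add)
  qed
  then show "(c * of_rat p) +o (c *o \<int>) = (c * of_rat q) +o (c *o (\<int> :: real set))"
    unfolding set_eq_iff mem_coset_iff by blast
qed

lemma coset_add:
  "((c * of_rat p) +o (c *o \<int>)) + ((c * of_rat q) +o (c *o \<int>)) =
    (c * of_rat (p + q)) +o (c *o (\<int> :: real set))"
proof -
  \<comment> \<open>Cosets are added as sets, so the subgroup added to itself must give itself
    back.\<close>
  have "c *o \<int> + c *o \<int> = c *o (\<int> :: real set)"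
  proof (intro equalityI subsetI)
    fix x assume "x \<in> c *o (\<int> :: real set)"
    moreover have "0 \<in> c *o (\<int> :: real set)" unfolding mem_elt_times_Ints by (rule exI[of _ 0]) simp
    ultimately have "x + 0 \<in> c *o \<int> + c *o (\<int> :: real set)" by (rule set_plus_intro)
    then show "x \<in> c *o \<int> + c *o (\<int> :: real set)" by simp
  qed (auto elim!: set_plus_elim intro: Ints_multiples_add)
  then show ?thesis by (simp add: set_plus_rearrange of_rat_add distrib_left)
qed

text \<open>The lattice determines c through its covolume, and then the labels determine the values
  of \<rho> in Q/Z.\<close>

lemma qlat_inj:
  assumes "c > 0" "d > 0" "qlat c \<rho> = qlat d \<sigma>"
  shows "c = d" "\<rho> = \<sigma>"
proof -
  show cd: "c = d" using assms Ints_multiples_inj by (metis fst_qlat)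
  show "\<rho> = \<sigma>"
  proof (rule zhat_eqI)
    fix q
    obtain a b where ab: "zhat_app \<rho> (mk_qz q) = mk_qz a" "zhat_app \<sigma> (mk_qz q) = mk_qz b"
      by (metis mk_qz_cases)
    have "(c * of_rat a) +o (c *o \<int>) = (c * of_rat b) +o (c *o \<int>)"
      using assms(3) cd snd_qlat[OF ab(1)] snd_qlat[OF ab(2)] by metis
    then show "zhat_app \<rho> (mk_qz q) = zhat_app \<sigma> (mk_qz q)"
      using ab coset_eq_iff[OF assms(1)] by simp
  qed
qed

text \<open>A lattice has a positive generator c, and dividing the labels by c turns \<phi> into an
  endomorphism of Q/Z, which is \<rho>.\<close>

lemma q_lattices_eq: "q_lattices = {qlat c \<rho> | c \<rho>. c > 0}"
proof (intro equalityI subsetI)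
  fix l assume l: "l \<in> {qlat c \<rho> | c \<rho>. c > 0}"
  then obtain c \<rho> where c: "c > 0" and l: "l = qlat c \<rho>" by blast
  have "\<exists>t\<in>rational_span (c *o \<int>). snd l x = t +o (c *o \<int>)" for x
  proof -
    obtain p where "zhat_app \<rho> x = mk_qz p" by (rule mk_qz_cases)
    moreover have "c * of_rat p \<in> rational_span (c *o \<int>)"
      unfolding rational_span_def mem_elt_times_Ints
      by (intro CollectI exI[of _ p] exI[of _ c]) (auto intro: exI[of _ 1])
    ultimately show ?thesis unfolding l using snd_qlat by blast
  qed
  moreover have "snd l (x + y) = snd l x + snd l y" for x y
  proof -
    obtain p q where pq: "zhat_app \<rho> x = mk_qz p" "zhat_app \<rho> y = mk_qz q" by (metis mk_qz_cases)
    then have "zhat_app \<rho> (x + y) = mk_qz (p + q)" by (simp add: zhat_app_add mk_qz_add)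
    then show ?thesis unfolding l by (simp add: snd_qlat pq coset_add)
  qed
  moreover have "is_lattice (c *o \<int>)" using c is_lattice_iff by blast
  ultimately have "(c *o \<int>, snd l) \<in> q_lattices" unfolding q_lattices_def by blast
  moreover have "l = (c *o \<int>, snd l)" by (simp add: l prod_eq_iff)
  ultimately show "l \<in> q_lattices" by simp
next
  fix l assume "l \<in> q_lattices"
  then obtain \<Lambda> \<phi> where l: "l = (\<Lambda>, \<phi>)" and \<Lambda>: "is_lattice \<Lambda>"
    and span: "\<And>x. \<exists>t\<in>rational_span \<Lambda>. \<phi> x = t +o \<Lambda>" and add: "\<And>x y. \<phi> (x + y) = \<phi> x + \<phi> y"
    unfolding q_lattices_def by blast
  obtain c where c: "c > 0" and \<Lambda>: "\<Lambda> = c *o \<int>" using \<Lambda> is_lattice_iff by blast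
  have "\<exists>p. \<phi> x = (c * of_rat p) +o (c *o \<int>)" for x
  proof -
    obtain q n where "\<phi> x = (of_rat q * (c * of_int n)) +o (c *o \<int>)"
      using span[of x] unfolding \<Lambda> rational_span_def mem_elt_times_Ints by blast
    then have "\<phi> x = (c * of_rat (q * of_int n)) +o (c *o \<int>)" by (simp add: of_rat_mult ac_simps)
    then show ?thesis by blast
  qed
  \<comment> \<open>The representatives \<open>p x\<close> are chosen arbitrarily and need not be
    additive; their classes modulo the integers are.\<close>
  then obtain p where p: "\<And>x. \<phi> x = (c * of_rat (p x)) +o (c *o \<int>)" by metis
  have "mk_qz (p (x + y)) = mk_qz (p x) + mk_qz (p y)" for x y
    using add[of x y] unfolding p coset_add coset_eq_iff[OF c] by (simp add: mk_qz_add)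
  then have "zhat_app (Abs_zhat (\<lambda>x. mk_qz (p x))) x = mk_qz (p x)" for x
    by (subst Abs_zhat_inverse) auto
  then have "snd (qlat c (Abs_zhat (\<lambda>x. mk_qz (p x)))) = \<phi>"
    using snd_qlat p by (metis ext)
  then have "l = qlat c (Abs_zhat (\<lambda>x. mk_qz (p x)))" by (simp add: l \<Lambda> prod_eq_iff)
  then show "l \<in> {qlat c \<rho> | c \<rho>. c > 0}" using c by blast
qed

lemma qlat_in_q_lattices: "c > 0 \<Longrightarrow> qlat c \<rho> \<in> q_lattices"
  unfolding q_lattices_eq by blast

section \<open>Commensurability\<close>

text \<open>The intersection contains all multiples of c a, so the elements c k with 0 \<le> k < a
  represent all cosets.\<close>

lemma finite_index_multiples_Int:
  assumes "c * of_int a = d * of_int b" "a > 0"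
  shows "finite_index (c *o \<int> \<inter> d *o \<int>) (c *o (\<int> :: real set))"
proof -
  let ?H = "c *o \<int> \<inter> d *o (\<int> :: real set)"
  have e: "c * of_int (a * k) \<in> ?H" for k
  proof -
    have "c * of_int (a * k) = d * of_int (b * k)" using assms(1) by simp
    then show ?thesis unfolding Int_iff mem_elt_times_Ints by blast
  qed
  have "{x +o ?H | x. x \<in> c *o \<int>} \<subseteq> (\<lambda>k. (c * of_int k) +o ?H) ` {0..<a}"
  proof clarify
    fix x assume "x \<in> c *o (\<int> :: real set)"
    then obtain n where n: "x = c * of_int n" unfolding mem_elt_times_Ints by blast
    have "n = n mod a + a * (n div a)" by simp
    then have "x = c * of_int (n mod a) + c * of_int (a * (n div a))"
      unfolding n by (metis distrib_left of_int_add)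
    then have "x +o ?H = (c * of_int (n mod a)) +o (c * of_int (a * (n div a)) +o ?H)"
      by (simp only: set_plus_rearrange2)
    moreover have "c * of_int (a * (n div a)) +o ?H = ?H"
    proof (intro equalityI subsetI)
      fix y assume "y \<in> c * of_int (a * (n div a)) +o ?H"
      then show "y \<in> ?H" using e[of "n div a"] by (auto simp: elt_set_plus_def intro: Ints_multiples_add)
    next
      fix y assume y: "y \<in> ?H"
      then have "y - c * of_int (a * (n div a)) \<in> ?H" using e[of "n div a"] by (auto intro: Ints_multiples_diff)
      then show "y \<in> c * of_int (a * (n div a)) +o ?H" by (force simp: elt_set_plus_def)
    qed
    ultimately show "x +o ?H \<in> (\<lambda>k. (c * of_int k) +o ?H) ` {0..<a}"
      using assms(2) by auto
  qed
  then have "finite {x +o ?H | x. x \<in> c *o \<int>}" by (rule finite_subset) simp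
  then show ?thesis unfolding finite_index_def by simp
qed

text \<open>Without a common nonzero multiple the intersection is trivial, and each of the
  infinitely many multiples of c is its own coset.\<close>

lemma finite_index_multiples_IntD:
  assumes "finite_index (c *o \<int> \<inter> d *o \<int>) (c *o (\<int> :: real set))" "c \<noteq> 0"
  shows "\<exists>m n. m \<noteq> 0 \<and> c * of_int m = d * of_int n"
proof (rule ccontr)
  assume neg: "\<not> ?thesis"
  have H: "c *o \<int> \<inter> d *o (\<int> :: real set) = {0}"
  proof (intro equalityI subsetI)
    fix x assume "x \<in> c *o \<int> \<inter> d *o (\<int> :: real set)"
    then obtain m n where "x = c * of_int m" "x = d * of_int n" unfolding Int_iff mem_elt_times_Ints by blast
    then show "x \<in> {0}" using neg by (metis mult_eq_0_iff of_int_0 singletonI)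
  next
    fix x :: real assume "x \<in> {0}"
    then show "x \<in> c *o \<int> \<inter> d *o (\<int> :: real set)"
      unfolding Int_iff mem_elt_times_Ints by (auto intro: exI[of _ 0])
  qed
  have "(\<lambda>n::int. {c * of_int n}) ` UNIV \<subseteq> {x +o {0} | x. x \<in> c *o (\<int> :: real set)}"
    by (auto simp: mem_elt_times_Ints elt_set_plus_def)
  moreover have "finite {x +o {0} | x. x \<in> c *o (\<int> :: real set)}"
    using assms(1) unfolding H finite_index_def by blast
  ultimately have "finite ((\<lambda>n::int. {c * of_int n}) ` UNIV)" by (rule finite_subset)
  moreover have "inj (\<lambda>n::int. {c * of_int n})" using assms(2) by (auto intro: injI)
  ultimately show False using finite_imageD infinite_UNIV_int by blast
qed

text \<open>Up to scaling by c, this is Z + (a / b) Z = (1 / b) Z for coprime a and b.\<close>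

lemma mem_sum_multiples_iff:
  fixes c t :: real
  assumes "c \<noteq> 0" "b > 0" "coprime a b"
  shows "c * t \<in> c *o \<int> + (c * (of_int a / of_int b)) *o \<int> \<longleftrightarrow> of_int b * t \<in> \<int>"
proof
  assume "c * t \<in> c *o \<int> + (c * (of_int a / of_int b)) *o \<int>"
  then obtain m n where "c * t = c * of_int m + c * (of_int a / of_int b) * of_int n"
    by (elim set_plus_elim) (auto simp: mem_elt_times_Ints)
  then have "c * t = c * (of_int m + of_int a / of_int b * of_int n)" by (simp add: algebra_simps)
  then have "t = of_int m + of_int a / of_int b * of_int n" using assms by simp
  then have "of_int b * t = of_int (b * m + a * n)" using assms by (simp add: field_simps)
  then show "of_int b * t \<in> \<int>" by (metis Ints_of_int)
next
  assume "of_int b * t \<in> \<int>"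
  then obtain k where k: "of_int b * t = of_int k" by (auto elim: Ints_cases)
  \<comment> \<open>Bezout coefficients split k / b into an integer and an integer multiple of a /
    b.\<close>
  obtain u v where uv: "u * a + v * b = 1" using assms(3) bezout_int[of a b] by auto
  have "of_int b * t = of_int k * of_int (u * a + v * b)" using k uv by simp
  then have "c * t = c * of_int (k * v) + (c * (of_int a / of_int b)) * of_int (k * u)"
    using assms by (simp add: field_simps)
  then show "c * t \<in> c *o \<int> + (c * (of_int a / of_int b)) *o \<int>"
    by (metis set_plus_intro mem_elt_times_Ints)
qed

text \<open>Let r = a / b in lowest terms. After division by c, the labels at q agree modulo (1 / b)
  Z exactly if b \<rho> and a \<sigma> agree at q; divisibility of Q then rewrites b \<rho> = a
  \<sigma> as \<rho> = r \<sigma>.\<close>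

lemma labels_congruent_iff:
  assumes "c > 0" "r > 0" and d: "d = c * of_rat r"
  shows "(\<forall>x. \<forall>u\<in>snd (qlat c \<rho>) x. \<forall>v\<in>snd (qlat d \<sigma>) x. u - v \<in> c *o \<int> + d *o \<int>) \<longleftrightarrow>
     (\<forall>q. zhat_app \<rho> (mk_qz q) = zhat_app \<sigma> (mk_qz (r * q)))" (is "?lhs \<longleftrightarrow> ?rhs")
proof -
  obtain a b where qo: "quotient_of r = (a, b)" by fastforce
  then have ab: "r = of_int a / of_int b" "b > 0" "coprime a b"
    using quotient_of_div quotient_of_denom_pos quotient_of_coprime by blast+
  have rr: "of_rat r = (of_int a / of_int b :: real)" by (simp add: ab(1) of_rat_divide)
  let ?S = "c *o \<int> + d *o (\<int> :: real set)"
  have S: "c * t \<in> ?S \<longleftrightarrow> of_int b * t \<in> \<int>" for t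
    using mem_sum_multiples_iff[of c b a t] assms ab by (simp add: of_rat_divide)
  have pointwise: "(\<forall>u\<in>snd (qlat c \<rho>) (mk_qz q). \<forall>v\<in>snd (qlat d \<sigma>) (mk_qz q). u - v \<in> ?S) \<longleftrightarrow>
      zhat_app \<rho> (mk_qz (of_int b * q)) = zhat_app \<sigma> (mk_qz (of_int a * q))" for q
  proof -
    obtain p s where ps: "zhat_app \<rho> (mk_qz q) = mk_qz p" "zhat_app \<sigma> (mk_qz q) = mk_qz s"
      by (metis mk_qz_cases)
    \<comment> \<open>Other representatives of the two cosets change b times the difference, taken
      after division by c, by the integer b m - a n, so one pair of representatives decides.\<close>
    have diff: "c * (of_rat p + of_int m) - d * (of_rat s + of_int n) \<in> ?S \<longleftrightarrow>
        of_int b * p - of_int a * s \<in> \<int>" for m n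
    proof -
      have "c * (of_rat p + of_int m) - d * (of_rat s + of_int n) =
          c * (of_rat p + of_int m - of_rat r * (of_rat s + of_int n))"
        by (simp add: d algebra_simps)
      moreover have "of_int b * (of_rat p + of_int m - of_rat r * (of_rat s + of_int n)) =
          (of_rat (of_int b * p - of_int a * s + of_int (b * m - a * n)) :: real)"
        using ab(2) by (simp add: rr of_rat_add of_rat_diff of_rat_mult field_simps)
      ultimately have "c * (of_rat p + of_int m) - d * (of_rat s + of_int n) \<in> ?S \<longleftrightarrow>
          of_int b * p - of_int a * s + of_int (b * m - a * n) \<in> \<int>"
        by (simp only: S of_rat_diff_Ints_iff)
      also have "\<dots> \<longleftrightarrow> of_int b * p - of_int a * s \<in> \<int>"
        by (metis Ints_add Ints_diff Ints_of_int add_diff_cancel_right')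
      finally show ?thesis .
    qed
    have "(\<forall>u\<in>snd (qlat c \<rho>) (mk_qz q). \<forall>v\<in>snd (qlat d \<sigma>) (mk_qz q). u - v \<in> ?S) \<longleftrightarrow>
        of_int b * p - of_int a * s \<in> \<int>"
      unfolding Ball_def snd_qlat[OF ps(1)] snd_qlat[OF ps(2)] mem_coset_iff using diff by blast
    also have "\<dots> \<longleftrightarrow> zhat_app \<rho> (mk_qz (of_int b * q)) = zhat_app \<sigma> (mk_qz (of_int a * q))"
      by (simp add: zhat_app_int_multiple[OF ps(1)] zhat_app_int_multiple[OF ps(2)] qz.abs_eq_iff)
    finally show ?thesis .
  qed
  have "?lhs \<longleftrightarrow> (\<forall>q. \<forall>u\<in>snd (qlat c \<rho>) (mk_qz q). \<forall>v\<in>snd (qlat d \<sigma>) (mk_qz q). u - v \<in> ?S)"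
    by (metis mk_qz_cases)
  also have "\<dots> \<longleftrightarrow> ?rhs"
    unfolding pointwise ab(1) using ab(2) by (simp add: zhat_app_cross_mult_iff)
  finally show ?thesis .
qed

lemma commensurable_qlat_iff:
  assumes c: "c > 0" and d: "d > 0"
  shows "(qlat c \<rho>, qlat d \<sigma>) \<in> commensurable \<longleftrightarrow>
    (\<exists>r. (r, \<sigma>) \<in> G_arrows \<and> \<rho> = rat_mult_zhat r \<sigma> \<and> d = c * of_rat r)"
proof -
  have "(l1, l2) \<in> commensurable \<longleftrightarrow> l1 \<in> q_lattices \<and> l2 \<in> q_lattices \<and>
     finite_index (fst l1 \<inter> fst l2) (fst l1) \<and> finite_index (fst l1 \<inter> fst l2) (fst l2) \<and>
     (\<forall>x. \<forall>u\<in>snd l1 x. \<forall>v\<in>snd l2 x. u - v \<in> fst l1 + fst l2)" for l1 l2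
    by (cases l1; cases l2) (simp add: commensurable_def)
  then have comm: "(qlat c \<rho>, qlat d \<sigma>) \<in> commensurable \<longleftrightarrow>
     finite_index (c *o \<int> \<inter> d *o \<int>) (c *o \<int>) \<and> finite_index (c *o \<int> \<inter> d *o \<int>) (d *o \<int>) \<and>
     (\<forall>x. \<forall>u\<in>snd (qlat c \<rho>) x. \<forall>v\<in>snd (qlat d \<sigma>) x. u - v \<in> c *o \<int> + d *o \<int>)"
    using qlat_in_q_lattices[OF c] qlat_in_q_lattices[OF d] by simp
  show ?thesis
  proof
    assume "(qlat c \<rho>, qlat d \<sigma>) \<in> commensurable"
    note l = this[unfolded comm]
    \<comment> \<open>Finite index supplies a common nonzero multiple of the two generators, and its
      coefficients give the rational ratio r.\<close>
    obtain m n where mn: "m \<noteq> 0" "c * of_int m = d * of_int n"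
      using finite_index_multiples_IntD l c by (metis less_irrefl)
    then have "n \<noteq> 0" using c by auto
    define r :: rat where "r = of_int m / of_int n"
    have dr: "d = c * of_rat r" using mn \<open>n \<noteq> 0\<close> by (simp add: r_def of_rat_divide field_simps)
    then have "r > 0" using c d by (simp add: zero_less_mult_iff)
    then have "\<forall>q. zhat_app \<rho> (mk_qz q) = zhat_app \<sigma> (mk_qz (r * q))"
      using l labels_congruent_iff[OF c _ dr] by blast
    then have "(r, \<sigma>) \<in> G_arrows" "\<rho> = rat_mult_zhat r \<sigma>"
      using ex_rat_multiple_iff[of \<sigma> r] \<open>r > 0\<close> rat_mult_zhat_unique[of \<rho> \<sigma> r]
      unfolding G_arrows_iff by auto
    then show "\<exists>r. (r, \<sigma>) \<in> G_arrows \<and> \<rho> = rat_mult_zhat r \<sigma> \<and> d = c * of_rat r" using dr by blast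
  next
    assume "\<exists>r. (r, \<sigma>) \<in> G_arrows \<and> \<rho> = rat_mult_zhat r \<sigma> \<and> d = c * of_rat r"
    then obtain r where r: "(r, \<sigma>) \<in> G_arrows" "\<rho> = rat_mult_zhat r \<sigma>" "d = c * of_rat r" by blast
    then have r0: "r > 0" by (simp add: G_arrows_iff)
    obtain a b where ab: "r = of_int a / of_int b" "b > 0"
      by (metis quotient_of_denom_pos quotient_of_div surj_pair)
    then have a: "a > 0" using r0 by (simp add: zero_less_divide_iff)
    \<comment> \<open>This common multiple bounds the index of the intersection in the first lattice
      by a and in the second by b.\<close>
    have "c * of_int a = d * of_int b" using ab by (simp add: r of_rat_divide)
    then have "finite_index (c *o \<int> \<inter> d *o \<int>) (c *o \<int>)" "finite_index (d *o \<int> \<inter> c *o \<int>) (d *o \<int>)"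
      using a ab(2) finite_index_multiples_Int by metis+
    then show "(qlat c \<rho>, qlat d \<sigma>) \<in> commensurable"
      unfolding comm using labels_congruent_iff[OF c r0 r(3)] zhat_app_rat_mult r by (simp add: Int_commute)
  qed
qed

section \<open>Scaling orbits of commensurable pairs\<close>

text \<open>For c = 1 this is the pair in the definition of \<gamma>, and c scales it. The parameter
  is thus the generator of the second lattice.\<close>

definition lattice_arrow :: "real \<Rightarrow> rat \<times> zhat \<Rightarrow> q_lattice \<times> q_lattice" where
  "lattice_arrow c = (\<lambda>(r, \<rho>). (qlat (c / of_rat r) (rat_mult_zhat r \<rho>), qlat c \<rho>))"

lemma commensurable_eq: "commensurable = {lattice_arrow c g | c g. c > 0 \<and> g \<in> G_arrows}"
proof (intro equalityI subsetI)
  fix p assume p: "p \<in> commensurable"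
  then have "fst p \<in> q_lattices" "snd p \<in> q_lattices" by (auto simp: commensurable_def)
  then obtain c d \<rho> \<sigma> where "fst p = qlat c \<rho>" "snd p = qlat d \<sigma>" and cd: "c > 0" "d > 0"
    unfolding q_lattices_eq by blast
  then have peq: "p = (qlat c \<rho>, qlat d \<sigma>)" by (simp add: prod_eq_iff)
  then obtain r where r: "(r, \<sigma>) \<in> G_arrows" "\<rho> = rat_mult_zhat r \<sigma>" "d = c * of_rat r"
    using p commensurable_qlat_iff[OF cd] by blast
  moreover have "r \<noteq> 0" using r(1) by (simp add: G_arrows_iff)
  ultimately have "p = lattice_arrow d (r, \<sigma>)" using cd by (simp add: peq lattice_arrow_def)
  then show "p \<in> {lattice_arrow c g | c g. c > 0 \<and> g \<in> G_arrows}" using r cd by blast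
next
  fix p assume "p \<in> {lattice_arrow c g | c g. c > 0 \<and> g \<in> G_arrows}"
  then obtain c r \<rho> where p: "p = lattice_arrow c (r, \<rho>)" "c > 0" "(r, \<rho>) \<in> G_arrows" by auto
  then have "r > 0" by (simp add: G_arrows_iff)
  then have "c / of_rat r > 0" using p by simp
  then show "p \<in> commensurable"
    unfolding p lattice_arrow_def prod.case using p \<open>r > 0\<close>
    by (subst commensurable_qlat_iff) (auto intro!: exI[of _ r])
qed

lemma scaling_orbit_lattice_arrow:
  assumes "c > 0"
  shows "scaling_orbit (lattice_arrow c g) = {lattice_arrow a g | a. a > 0}"
proof -
  obtain r \<rho> where g: "g = (r, \<rho>)" by fastforce
  have eq: "scaling_orbit (lattice_arrow c g) = {lattice_arrow (a * c) g | a. a > 0}"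
    by (simp add: scaling_orbit_def lattice_arrow_def g)
  \<comment> \<open>The parameter a is reached from c by scaling with a / c, so the orbit does not
    depend on c.\<close>
  have "\<exists>b. lattice_arrow a g = lattice_arrow (b * c) g \<and> b > 0" if "a > 0" for a
    using that assms by (intro exI[of _ "a / c"]) simp
  then show ?thesis unfolding eq using assms by (auto intro: mult_pos_pos)
qed

lemma gamma_map_eq: "gamma_map g = {lattice_arrow c g | c. c > 0}"
proof -
  have "gamma_map g = scaling_orbit (lattice_arrow 1 g)"
    by (cases g) (simp add: gamma_map_def lattice_arrow_def integer_lattice_eq_qlat inverse_eq_divide)
  then show ?thesis by (simp add: scaling_orbit_lattice_arrow)
qed

text \<open>The middle lattices must coincide, so for each c exactly one scaling d fits. This makes
  the product of two orbits a single orbit.\<close>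

lemma composable_lattice_arrow_iff:
  assumes "c > 0" "d > 0" "(r, \<rho>) \<in> G_arrows" "(s, \<sigma>) \<in> G_arrows"
  shows "(lattice_arrow d (r, \<rho>), lattice_arrow c (s, \<sigma>)) \<in> composable commensurability_groupoid \<longleftrightarrow>
    d = c / of_rat s \<and> \<rho> = rat_mult_zhat s \<sigma>"
proof -
  have "lattice_arrow d (r, \<rho>) \<in> commensurable" "lattice_arrow c (s, \<sigma>) \<in> commensurable"
    using assms commensurable_eq by auto
  then have "(lattice_arrow d (r, \<rho>), lattice_arrow c (s, \<sigma>)) \<in> composable commensurability_groupoid \<longleftrightarrow>
      qlat d \<rho> = qlat (c / of_rat s) (rat_mult_zhat s \<sigma>)"
    by (simp add: commensurability_groupoid_def lattice_arrow_def)
  moreover have "c / of_rat s > 0" using assms by (simp add: G_arrows_iff)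
  ultimately show ?thesis using qlat_inj assms(2) by blast
qed

lemma composable_mod_scaling:
  "composable commensurability_mod_scaling = map_prod gamma_map gamma_map ` composable G_groupoid"
proof -
  have gamma: "scaling_orbit (lattice_arrow c g) = gamma_map g" if "c > 0" for c g
    using that by (simp add: gamma_map_eq scaling_orbit_lattice_arrow)
  show ?thesis
  proof (intro equalityI subsetI)
    fix z assume "z \<in> composable commensurability_mod_scaling"
    then obtain p q where z: "z = (scaling_orbit p, scaling_orbit q)"
      and pq: "(p, q) \<in> composable commensurability_groupoid"
      by (auto simp: commensurability_mod_scaling_def quotient_groupoid_def)
    then have "p \<in> commensurable" "q \<in> commensurable" by (auto simp: commensurability_groupoid_def)
    then obtain c d r s \<rho> \<sigma> where "p = lattice_arrow d (r, \<rho>)" "q = lattice_arrow c (s, \<sigma>)"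
      "c > 0" "d > 0" "(r, \<rho>) \<in> G_arrows" "(s, \<sigma>) \<in> G_arrows"
      unfolding commensurable_eq by auto
    then have "z = map_prod gamma_map gamma_map ((r, \<rho>), (s, \<sigma>))"
      "((r, \<rho>), (s, \<sigma>)) \<in> composable G_groupoid"
      using pq composable_lattice_arrow_iff by (simp_all add: z gamma composable_G_iff)
    then show "z \<in> map_prod gamma_map gamma_map ` composable G_groupoid" by blast
  next
    fix z assume "z \<in> map_prod gamma_map gamma_map ` composable G_groupoid"
    then obtain r s \<rho> \<sigma> where z: "z = (gamma_map (r, \<rho>), gamma_map (s, \<sigma>))"
      and g: "(r, \<rho>) \<in> G_arrows" "(s, \<sigma>) \<in> G_arrows" "\<rho> = rat_mult_zhat s \<sigma>"
      by (auto simp: composable_G_iff)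
    \<comment> \<open>Scaling the first pair by 1 / s makes its second lattice equal to the first
      lattice of the second pair, whose parameter is 1.\<close>
    have s: "1 / of_rat s > (0::real)" using g by (simp add: G_arrows_iff)
    then have "(lattice_arrow (1 / of_rat s) (r, \<rho>), lattice_arrow 1 (s, \<sigma>)) \<in> composable commensurability_groupoid"
      using g by (simp add: composable_lattice_arrow_iff)
    moreover have "z = map_prod scaling_orbit scaling_orbit
        (lattice_arrow (1 / of_rat s) (r, \<rho>), lattice_arrow 1 (s, \<sigma>))"
      using gamma[OF s] by (simp add: z gamma)
    ultimately show "z \<in> composable commensurability_mod_scaling"
      by (simp only: commensurability_mod_scaling_def quotient_groupoid_def top_groupoid.simps image_eqI)
  qed
qed

text \<open>Orbits are multiplied elementwise, but only the choices with d = c / s are composable,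
  and their products run through one orbit.\<close>

lemma gcomp_gamma_map:
  assumes "(g, h) \<in> composable G_groupoid"
  shows "gcomp commensurability_mod_scaling (gamma_map g) (gamma_map h) = gamma_map (gcomp G_groupoid g h)"
proof -
  obtain r \<rho> s \<sigma> where gh: "g = (r, \<rho>)" "h = (s, \<sigma>)" by fastforce
  then have g: "(r, \<rho>) \<in> G_arrows" "(s, \<sigma>) \<in> G_arrows" "\<rho> = rat_mult_zhat s \<sigma>"
    using assms by (auto simp: composable_G_iff)
  then have s: "of_rat s > (0::real)" by (simp add: G_arrows_iff)
  let ?R = "commensurability_groupoid"
  have comp: "gcomp ?R (lattice_arrow (c / of_rat s) g) (lattice_arrow c h) =
      lattice_arrow c (gcomp G_groupoid g h)" for c
    using g by (simp add: gh commensurability_groupoid_def lattice_arrow_def rat_mult_zhat_mult of_rat_mult field_simps)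
  have "gcomp commensurability_mod_scaling (gamma_map g) (gamma_map h) =
      {gcomp ?R a b | a b. a \<in> gamma_map g \<and> b \<in> gamma_map h \<and> (a, b) \<in> composable ?R}"
    by (simp add: commensurability_mod_scaling_def quotient_groupoid_def)
  also have "\<dots> = {gcomp ?R (lattice_arrow d g) (lattice_arrow c h) | c d. d > 0 \<and> c > 0 \<and> d = c / of_rat s}"
  proof -
    have "(lattice_arrow d g, lattice_arrow c h) \<in> composable ?R \<longleftrightarrow> d = c / of_rat s"
      if "d > 0" "c > 0" for c d
      using composable_lattice_arrow_iff that g by (simp add: gh)
    then show ?thesis unfolding gamma_map_eq by blast
  qed
  also have "\<dots> = {gcomp ?R (lattice_arrow (c / of_rat s) g) (lattice_arrow c h) | c. c > 0}"
    using s by auto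
  finally show ?thesis by (simp only: comp gamma_map_eq)
qed

text \<open>Exchanging the two lattices puts the one with generator c / r in second place, so c / r
  is the new parameter.\<close>

lemma ginv_gamma_map:
  assumes "g \<in> G_arrows"
  shows "ginv commensurability_mod_scaling (gamma_map g) = gamma_map (ginv G_groupoid g)"
proof -
  obtain r \<rho> where g: "g = (r, \<rho>)" by fastforce
  have r: "of_rat r > (0::real)" using assms by (simp add: g G_arrows_iff)
  have inv: "ginv commensurability_groupoid (lattice_arrow c g) = lattice_arrow (c / of_rat r) (ginv G_groupoid g)" for c
    using r rat_mult_zhat_inverse assms
    by (simp add: g commensurability_groupoid_def lattice_arrow_def of_rat_inverse)
  have "ginv commensurability_mod_scaling (gamma_map g) = {lattice_arrow (c / of_rat r) (ginv G_groupoid g) | c. c > 0}"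
    unfolding gamma_map_eq by (auto simp: commensurability_mod_scaling_def quotient_groupoid_def inv[symmetric])
  also have "\<dots> = {lattice_arrow c (ginv G_groupoid g) | c. c > 0}"
  proof -
    have "\<exists>b. lattice_arrow a h = lattice_arrow (b / of_rat r) h \<and> b > 0" if "a > 0" for a h
      using that r by (intro exI[of _ "a * of_rat r"]) simp
    then show ?thesis using r by (blast intro: divide_pos_pos)
  qed
  finally show ?thesis by (simp only: gamma_map_eq)
qed

text \<open>The inverse of \<open>gamma_map\<close> reads \<open>r\<close> off the covolumes and \<open>\<rho>\<close> off the second
  lattice.\<close>

definition qlat_label :: "q_lattice \<Rightarrow> zhat" where
  "qlat_label l = (THE \<rho>. \<exists>c>0. l = qlat c \<rho>)"

lemma qlat_label_qlat [simp]: "c > 0 \<Longrightarrow> qlat_label (qlat c \<rho>) = \<rho>"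
  unfolding qlat_label_def by (rule the_equality) (use qlat_inj in blast)+

text \<open>The covolume ratio is a real number; on commensurable pairs it is rational, and
  \<open>inv of_rat\<close> reads it as an element of Q.\<close>

definition arrow_of_pair :: "q_lattice \<times> q_lattice \<Rightarrow> rat \<times> zhat" where
  "arrow_of_pair = (\<lambda>(l1, l2). (inv of_rat (covolume (fst l2) / covolume (fst l1)), qlat_label l2))"

lemma covolume_ratio_lattice_arrow:
  assumes "c > 0" "(r, \<rho>) \<in> G_arrows" "lattice_arrow c (r, \<rho>) = (l1, l2)"
  shows "covolume (fst l2) / covolume (fst l1) = of_rat r"
  using assms by (auto simp: lattice_arrow_def G_arrows_iff covolume_multiples)

lemma arrow_of_pair_lattice_arrow:
  assumes "c > 0" "g \<in> G_arrows"
  shows "arrow_of_pair (lattice_arrow c g) = g"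
proof -
  obtain r \<rho> where g: "g = (r, \<rho>)" by fastforce
  have "inv of_rat (of_rat r :: real) = r" by (rule inv_f_f) (simp add: inj_def)
  then show ?thesis
    using assms covolume_ratio_lattice_arrow[of c r \<rho>]
    by (simp add: arrow_of_pair_def g lattice_arrow_def)
qed

section \<open>Topologies on Q-lattices and on commensurable pairs\<close>

lemma quotient_map_qlat:
  "quotient_map (prod_topology (top_of_set {0<..}) zhat_topology) q_lattice_topology (\<lambda>(c, \<rho>). qlat c \<rho>)"
  unfolding q_lattice_topology_def qlat_def by (rule quotient_map_quotient_topology)

lemma topspace_q_lattice [simp]: "topspace q_lattice_topology = q_lattices"
proof -
  have "topspace q_lattice_topology = (\<lambda>(c, \<rho>). qlat c \<rho>) ` ({0<..} \<times> UNIV)"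
    using quotient_imp_surjective_map[OF quotient_map_qlat] by simp
  also have "\<dots> = q_lattices" unfolding q_lattices_eq image_def by fastforce
  finally show ?thesis .
qed

text \<open>In the coordinates (c, \<rho>) this is the second projection, and the coordinate map is
  a quotient map.\<close>

lemma continuous_map_qlat_label: "continuous_map q_lattice_topology zhat_topology qlat_label"
  by (rule continuous_compose_quotient_map[OF quotient_map_qlat])
    (rule continuous_map_eq[OF continuous_map_snd], auto)

lemma continuous_map_qlat_1: "continuous_map zhat_topology q_lattice_topology (qlat 1)"
proof -
  have "continuous_map zhat_topology (prod_topology (top_of_set {0<..}) zhat_topology) (\<lambda>\<rho>. (1::real, \<rho>))"
    by (simp add: continuous_map_pairwise comp_def)
  from continuous_map_compose[OF this quotient_imp_continuous_map[OF quotient_map_qlat]]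
  show ?thesis by (simp add: comp_def)
qed

lemma gtop_R: "gtop commensurability_groupoid = pullback_topology commensurable
    (\<lambda>(l1, l2). (covolume (fst l2) / covolume (fst l1), l2))
    (prod_topology (discrete_topology {q \<in> \<rat>. q > 0}) q_lattice_topology)"
  by (simp add: commensurability_groupoid_def)

text \<open>A pullback topology keeps only the points mapped into the target space, so the covolume
  ratio must be a positive rational on every commensurable pair.\<close>

lemma topspace_R: "topspace (gtop commensurability_groupoid) = commensurable"
proof -
  have "covolume (fst l2) / covolume (fst l1) \<in> {q \<in> \<rat>. q > 0} \<and> l2 \<in> q_lattices"
    if l: "(l1, l2) \<in> commensurable" for l1 l2
  proof -
    obtain c r \<rho> where a: "c > 0" "(r, \<rho>) \<in> G_arrows" "lattice_arrow c (r, \<rho>) = (l1, l2)"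
      using l unfolding commensurable_eq by auto
    then have "covolume (fst l2) / covolume (fst l1) = of_rat r" by (rule covolume_ratio_lattice_arrow)
    then show ?thesis using l a by (auto simp: commensurable_def G_arrows_iff)
  qed
  then show ?thesis by (auto simp: gtop_R topspace_pullback_topology)
qed

text \<open>Both components factor through the ratio and the second lattice, the map along which the
  topology of pairs is pulled back.\<close>

lemma continuous_map_arrow_of_pair:
  "continuous_map (gtop commensurability_groupoid) (gtop G_groupoid) arrow_of_pair"
  unfolding continuous_map_into_G topspace_R
proof (intro conjI)
  let ?f = "\<lambda>(l1, l2). (covolume (fst l2) / covolume (fst l1), l2) :: real \<times> q_lattice"
  let ?T = "prod_topology (discrete_topology {q \<in> \<rat>. q > 0}) q_lattice_topology :: (real \<times> q_lattice) topology"
  have "continuous_map ?T (discrete_topology UNIV) (inv of_rat \<circ> fst)"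
    by (rule continuous_map_compose[OF continuous_map_fst]) auto
  then have "continuous_map (gtop commensurability_groupoid) (discrete_topology UNIV) (inv of_rat \<circ> fst \<circ> ?f)"
    unfolding gtop_R by (rule continuous_map_pullback)
  then show "continuous_map (gtop commensurability_groupoid) (discrete_topology UNIV) (fst \<circ> arrow_of_pair)"
    by (rule continuous_map_eq) (auto simp: arrow_of_pair_def)
  have "continuous_map ?T zhat_topology (qlat_label \<circ> snd)"
    by (rule continuous_map_compose[OF continuous_map_snd continuous_map_qlat_label])
  then have "continuous_map (gtop commensurability_groupoid) zhat_topology (qlat_label \<circ> snd \<circ> ?f)"
    unfolding gtop_R by (rule continuous_map_pullback)
  then show "continuous_map (gtop commensurability_groupoid) zhat_topology (snd \<circ> arrow_of_pair)"
    by (rule continuous_map_eq) (auto simp: arrow_of_pair_def)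
  show "arrow_of_pair ` commensurable \<subseteq> G_arrows"
    unfolding commensurable_eq by (auto simp: arrow_of_pair_lattice_arrow)
qed

text \<open>This picks from each orbit the pair whose second lattice has generator 1. Continuity is
  tested on the ratio r and the lattice \<open>qlat 1 \<rho>\<close>.\<close>

lemma continuous_map_lattice_arrow_1:
  "continuous_map (gtop G_groupoid) (gtop commensurability_groupoid) (lattice_arrow 1)"
  unfolding gtop_R
proof (rule continuous_map_pullback')
  let ?f = "\<lambda>(l1, l2). (covolume (fst l2) / covolume (fst l1), l2) :: real \<times> q_lattice"
  let ?D = "discrete_topology {q \<in> \<rat>. q > (0::real)}"
  have "continuous_map (gtop G_groupoid) (discrete_topology {0<..}) fst"
    unfolding gtop_G by (rule continuous_map_from_subtopology[OF continuous_map_fst])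
  then have "continuous_map (gtop G_groupoid) ?D (of_rat \<circ> fst)"
    by (rule continuous_map_compose) auto
  moreover have "continuous_map (gtop G_groupoid) q_lattice_topology (qlat 1 \<circ> snd)"
    by (rule continuous_map_compose[OF continuous_map_snd_G continuous_map_qlat_1])
  ultimately have "continuous_map (gtop G_groupoid) (prod_topology ?D q_lattice_topology)
      (\<lambda>g. (of_rat (fst g), qlat 1 (snd g)))"
    by (simp add: continuous_map_pairwise comp_def)
  then show "continuous_map (gtop G_groupoid) (prod_topology ?D q_lattice_topology) (?f \<circ> lattice_arrow 1)"
    by (rule continuous_map_eq) (auto simp: lattice_arrow_def G_arrows_iff covolume_multiples
        covolume_multiples[of 1, simplified])
  show "topspace (gtop G_groupoid) \<subseteq> lattice_arrow 1 -` commensurable"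
    unfolding commensurable_eq topspace_G using zero_less_one by blast
qed

lemma quotient_map_scaling_orbit:
  "quotient_map (gtop commensurability_groupoid) (gtop commensurability_mod_scaling) scaling_orbit"
  by (simp add: commensurability_mod_scaling_def quotient_groupoid_def quotient_map_quotient_topology)

lemma homeomorphic_map_gamma_map:
  "homeomorphic_map (gtop G_groupoid) (gtop commensurability_mod_scaling) gamma_map"
proof -
  let ?R = "gtop commensurability_groupoid" and ?H = "gtop commensurability_mod_scaling"
  \<comment> \<open>\<open>\<delta>\<close> applies \<open>arrow_of_pair\<close> to an arbitrary
    pair of the orbit; the choice is harmless because that map is constant on orbits.\<close>
  define \<delta> where "\<delta> A = arrow_of_pair (SOME p. p \<in> A)" for A
  have \<delta>: "\<delta> (gamma_map g) = g" if g: "g \<in> G_arrows" for g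
  proof -
    have "lattice_arrow 1 g \<in> gamma_map g" unfolding gamma_map_eq using zero_less_one by blast
    then have "(SOME p. p \<in> gamma_map g) \<in> gamma_map g" by (rule someI)
    then obtain c where "c > 0" "(SOME p. p \<in> gamma_map g) = lattice_arrow c g"
      unfolding gamma_map_eq by blast
    then show ?thesis using g by (simp add: \<delta>_def arrow_of_pair_lattice_arrow)
  qed
  have orbit: "scaling_orbit (lattice_arrow c g) = gamma_map g" if "c > 0" for c g
    using that by (simp add: gamma_map_eq scaling_orbit_lattice_arrow)
  have "continuous_map (gtop G_groupoid) ?H (scaling_orbit \<circ> lattice_arrow 1)"
    by (rule continuous_map_compose[OF continuous_map_lattice_arrow_1
          quotient_imp_continuous_map[OF quotient_map_scaling_orbit]])
  then have "continuous_map (gtop G_groupoid) ?H gamma_map"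
    by (rule continuous_map_eq) (simp add: orbit)
  \<comment> \<open>Continuity out of the quotient is tested after the orbit map, where
    \<open>\<delta>\<close> becomes \<open>arrow_of_pair\<close>.\<close>
  moreover have "continuous_map ?H (gtop G_groupoid) \<delta>"
  proof (rule continuous_compose_quotient_map[OF quotient_map_scaling_orbit])
    show "continuous_map ?R (gtop G_groupoid) (\<delta> \<circ> scaling_orbit)"
      by (rule continuous_map_eq[OF continuous_map_arrow_of_pair])
        (auto simp: topspace_R commensurable_eq orbit \<delta> arrow_of_pair_lattice_arrow)
  qed
  moreover have "gamma_map (\<delta> A) = A" if "A \<in> topspace ?H" for A
  proof -
    have "A \<in> scaling_orbit ` commensurable"
      using that quotient_imp_surjective_map[OF quotient_map_scaling_orbit] by (simp add: topspace_R)
    then obtain g where "g \<in> G_arrows" "A = gamma_map g"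
      unfolding commensurable_eq by (auto simp: orbit)
    then show ?thesis by (simp add: \<delta>)
  qed
  ultimately have "homeomorphic_maps (gtop G_groupoid) ?H gamma_map \<delta>"
    by (simp add: homeomorphic_maps_def \<delta>)
  then show ?thesis using homeomorphic_map_maps by blast
qed

lemma top_groupoid_iso_gamma_map: "top_groupoid_iso G_groupoid commensurability_mod_scaling gamma_map"
  unfolding top_groupoid_iso_def
proof (intro conjI homeomorphic_map_gamma_map)
  \<comment> \<open>Composability in the quotient is an image under \<gamma>, so injectivity
    recovers the composable pair of G.\<close>
  have inj: "inj_on gamma_map G_arrows"
    using homeomorphic_imp_injective_map[OF homeomorphic_map_gamma_map] by simp
  have sub: "composable G_groupoid \<subseteq> G_arrows \<times> G_arrows" by (auto simp: composable_G_iff)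
  show "\<forall>g\<in>topspace (gtop G_groupoid). \<forall>h\<in>topspace (gtop G_groupoid).
      ((g, h) \<in> composable G_groupoid) = ((gamma_map g, gamma_map h) \<in> composable commensurability_mod_scaling)"
  proof (intro ballI iffI)
    fix g h assume gh: "g \<in> topspace (gtop G_groupoid)" "h \<in> topspace (gtop G_groupoid)"
    assume "(gamma_map g, gamma_map h) \<in> composable commensurability_mod_scaling"
    then obtain g' h' where "(g', h') \<in> composable G_groupoid" "gamma_map g = gamma_map g'"
      "gamma_map h = gamma_map h'" unfolding composable_mod_scaling by auto
    then show "(g, h) \<in> composable G_groupoid" using gh sub inj_onD[OF inj] by (metis SigmaD1 SigmaD2 subsetD topspace_G)
  qed (force simp: composable_mod_scaling)
  show "\<forall>(g, h)\<in>composable G_groupoid. gamma_map (gcomp G_groupoid g h) =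
      gcomp commensurability_mod_scaling (gamma_map g) (gamma_map h)"
    by (auto simp: gcomp_gamma_map)
qed

theorem proposition1p12:
  shows "lc_etale_groupoid G_groupoid \<and>
    lc_etale_groupoid commensurability_mod_scaling \<and>
    top_groupoid_iso G_groupoid commensurability_mod_scaling gamma_map"
proof (intro conjI lc_etale_groupoid_G top_groupoid_iso_gamma_map)
  show "lc_etale_groupoid commensurability_mod_scaling"
  proof (rule lc_etale_groupoid_transfer[OF lc_etale_groupoid_G top_groupoid_iso_gamma_map])
    have "topspace (gtop commensurability_mod_scaling) = gamma_map ` G_arrows"
      using homeomorphic_imp_surjective_map[OF homeomorphic_map_gamma_map] by simp
    then show "composable commensurability_mod_scaling \<subseteq>
        topspace (gtop commensurability_mod_scaling) \<times> topspace (gtop commensurability_mod_scaling)"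
      by (auto simp: composable_mod_scaling composable_G_iff)
  qed (simp add: ginv_gamma_map)
qed

end
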